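(* Let $(\xi_k)_{k\in\mathbb{Z}}$ be a stationary noise process with common law $\mu\in M^1(\mathbb{R}^d)$ and let $\phi$ be an invertible linear map on $\mathbb{R}^d$. Consider the equation $$\lambda_k=\mu*\phi(\lambda_{k-1}),\qquad k\in\mathbb{Z}.\tag{E}$$ The following are equivalent: (1) (E) has a (fundamental) solution; (2) the noise law $\mu$ is supported on a coset $u+C(\phi)$ of $C(\phi)$ for some $u\in\mathbb{R}^d$ and satisfies the logarithmic moment condition $$\int\log(\|v\|+1)\,d\mu(v)<\infty .$$ In this case, $(\nu*\delta_{u_k})_{k\in\mathbb{Z}}$ is a fundamental solution of (E), where $(u_k)_{k\in\mathbb{Z}}$ is a bi-sequence in $\mathbb{R}^d$ such that $u_k=u+\phi(u_{k-1})$ for all $k\in\mathbb{Z}$, and $$\nu=\mu*\delta_{-u}*\phi(\nu)=\lim_{k\to\infty}\ \Big(\prod_{i=1}^{k}\phi^{i-1}(\mu)\Big)*\delta_{-u_k};$$ in other words, $\nu$ is a strongly $\phi$-decomposable measure with co-factor $\mu*\delta_{-u}$.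
   Context: $M^1(\mathbb{R}^d)$ is the space of Borel probability measures on $\mathbb{R}^d$ with the weak topology; $*$ is convolution, products $\prod$ of measures are convolution products, $\delta_x$ is the Dirac measure at $x$, and $\phi(\nu)$ is the image (push-forward) of $\nu$ under $\phi$. $C(\phi)=\{v\in\mathbb{R}^d:\phi^n(v)\to0\text{ as }n\to\infty\}$ is the contraction subspace of $\phi$. A solution of (E) is a bi-sequence $(\lambda_k)_{k\in\mathbb{Z}}$ in $M^1(\mathbb{R}^d)$ satisfying (E) for all $k\in\mathbb{Z}$. A solution $(\lambda_k)$ is fundamental if for each solution $(\nu_k)$ of (E) there is $\rho\in M^1(\mathbb{R}^d)$ such that $\nu_k=\lambda_k*\phi^k(\rho)$ for all $k\in\mathbb{Z}$. The parenthesis in "(fundamental) solution" means that (1) may be read either with "solution" or with "fundamental solution". Bi-sequences $(u_k)$ with $u_k=u+\phi(u_{k-1})$ for all $k$ exist because $\phi$ is invertible. A measure $\rho\in M^1(\mathbb{R}^d)$ is strongly $\phi$-decomposable with co-factor $\sigma\in M^1(\mathbb{R}^d)$ if $\rho=\sigma*\phi(\rho)$ and $\phi^n(\rho)\to\delta_0$ as $n\to\infty$.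
   Formalization: The limit formula for ν is proved for bi-sequences with u_0 in C(φ), exactly those for which it holds; for arbitrary (u_k) it fails, e.g. φ = 2·id on R, μ = δ_0, u = 0, u_k = 2^k. All other claims hold for every bi-sequence. *)

theory Defs
  imports "HOL-Probability.Probability"
begin

definition borel_prob :: "'a::topological_space measure \<Rightarrow> bool" where
  "borel_prob M \<longleftrightarrow> prob_space M \<and> sets M = sets borel"

text \<open>Convergence in the weak topology, tested against bounded continuous functions; the library's
  \<^const>\<open>weak_conv_m\<close> covers only measures on the real line.\<close>

definition weakly_converges :: "(nat \<Rightarrow> 'a::topological_space measure) \<Rightarrow> 'a measure \<Rightarrow> bool" where
  "weakly_converges M N \<longleftrightarrow>
     (\<forall>f :: 'a \<Rightarrow> real. continuous_on UNIV f \<and> bounded (range f) \<longrightarrow>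
        (\<lambda>n. integral\<^sup>L (M n) f) \<longlonglongrightarrow> integral\<^sup>L N f)"

text \<open>Integer iterates; the negative ones are meaningful for bijective maps only.\<close>

definition iterate_int :: "('a \<Rightarrow> 'a) \<Rightarrow> int \<Rightarrow> 'a \<Rightarrow> 'a" where
  "iterate_int \<phi> k = (if 0 \<le> k then \<phi> ^^ nat k else inv \<phi> ^^ nat (- k))"

definition contraction_subspace :: "('a::real_normed_vector \<Rightarrow> 'a) \<Rightarrow> 'a set" where
  "contraction_subspace \<phi> = {v. (\<lambda>n. (\<phi> ^^ n) v) \<longlonglongrightarrow> 0}"

text \<open>The convolution product of the measures \<open>M i\<close> with \<open>1 \<le> i \<le> k\<close>.\<close>

primrec convolution_prod ::
    "(nat \<Rightarrow> 'a::ordered_euclidean_space measure) \<Rightarrow> nat \<Rightarrow> 'a measure" where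
  "convolution_prod M 0 = return borel 0"
| "convolution_prod M (Suc k) = (convolution_prod M k \<star> M (Suc k))"

definition solution ::
    "('a::ordered_euclidean_space \<Rightarrow> 'a) \<Rightarrow> 'a measure \<Rightarrow> (int \<Rightarrow> 'a measure) \<Rightarrow> bool" where
  "solution \<phi> \<mu> \<Lambda> \<longleftrightarrow>
     (\<forall>k. borel_prob (\<Lambda> k)) \<and> (\<forall>k. \<Lambda> k = (\<mu> \<star> distr (\<Lambda> (k - 1)) borel \<phi>))"

definition fundamental_solution ::
    "('a::ordered_euclidean_space \<Rightarrow> 'a) \<Rightarrow> 'a measure \<Rightarrow> (int \<Rightarrow> 'a measure) \<Rightarrow> bool" where
  "fundamental_solution \<phi> \<mu> \<Lambda> \<longleftrightarrow>
     solution \<phi> \<mu> \<Lambda> \<and>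
     (\<forall>N. solution \<phi> \<mu> N \<longrightarrow>
        (\<exists>\<rho>. borel_prob \<rho> \<and> (\<forall>k. N k = (\<Lambda> k \<star> distr \<rho> borel (iterate_int \<phi> k)))))"

definition strongly_decomposable ::
    "('a::ordered_euclidean_space \<Rightarrow> 'a) \<Rightarrow> 'a measure \<Rightarrow> 'a measure \<Rightarrow> bool" where
  "strongly_decomposable \<phi> \<rho> \<sigma> \<longleftrightarrow>
     borel_prob \<rho> \<and> borel_prob \<sigma> \<and> \<rho> = (\<sigma> \<star> distr \<rho> borel \<phi>) \<and>
     weakly_converges (\<lambda>n. distr \<rho> borel (\<phi> ^^ n)) (return borel 0)"

definition supported_on :: "'a measure \<Rightarrow> 'a set \<Rightarrow> bool" where
  "supported_on M A \<longleftrightarrow> (AE v in M. v \<in> A)"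

definition log_moment_condition :: "'a::real_normed_vector measure \<Rightarrow> bool" where
  "log_moment_condition M \<longleftrightarrow> (\<integral>\<^sup>+ v. ennreal (ln (norm v + 1)) \<partial>M) < \<infinity>"

text \<open>Only the one-dimensional laws of a noise process enter the equation, so no assumption is made
  on the dependence between different times; independent noise is a special case.\<close>

definition noise_with_law ::
    "'w measure \<Rightarrow> (int \<Rightarrow> 'w \<Rightarrow> 'a::topological_space) \<Rightarrow> 'a measure \<Rightarrow> bool" where
  "noise_with_law P \<xi> \<mu> \<longleftrightarrow>
     prob_space P \<and> (\<forall>k. \<xi> k \<in> measurable P borel \<and> distr P borel (\<xi> k) = \<mu>)"

end

(*
  Iterating (E) backwards writes lambda_0 as a convolution with the factors mu, phi(mu), ...,
  phi^(n-1)(mu), so the product of their characteristic functions stays bounded away from 0 near 0.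
  For the symmetrization W of mu this bounds sum_i W{|phi^i v| >= eps} for every eps > 0.
  Borel-Cantelli then puts W on C(phi), and since |phi^i v| >= c^i |v| the sum for eps = 1 counts at
  least a constant times log |v| indices, which is the logarithmic moment; Fubini undoes the
  symmetrization and produces u.

  Conversely phi contracts C(phi) geometrically, so by the logarithmic moment and Borel-Cantelli the
  series sum_i phi^i(Z_i), with Z_i independent of law sigma = mu * delta_{-u}, converges almost surely;
  nu is the law of its sum. Any solution, recentred to M_k = sigma * phi(M_{k-1}), satisfies
  R_n = phi^n(sigma) * R_{n+1} for R_n = phi^n(M_{-n}). Kolmogorov's extension theorem realizes the R_n
  as laws of variables V_n whose increments V_n - V_{n+1} have law phi^n(sigma), so V_n converges almost
  surely, and the law rho of the limit gives M_k = nu * phi^k(rho). This coupling replaces a tightness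
  argument for the sequence R_n.
*)

theory Submission
  imports Defs
begin

section \<open>Convolution and weak convergence\<close>

text \<open>Both directions rest on one count: for b > 1 the number of n with b^n < norm v is
  comparable to ln (norm v + 1) up to constants, so a logarithmic moment amounts to summable tails
  along a geometric sequence. The resulting tail estimate uses only the law \<phi>^n(\<sigma>) of
  each term and nothing about joint laws. Hence it serves twice: for the series defining \<nu>, and
  for the increments of the chain V_n, of which only the individual laws are recorded. The obstacle
  for an arbitrary solution is that a bi-infinite recursion has no initial time, so the V_n must be
  built from later to earlier indices, and only finite horizons can be written down directly. The
  solution at time k is then the law of X_m + \<phi>^k(V_n) with m - n = k, for the partial sums X_m
  of the series; letting m and n grow together identifies it. In the necessity part the
  symmetrization has two uses: the squared modulus of the characteristic function becomes an
  integral of cosines, and the unknown centre u drops out until a section of the symmetrized law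
  supplies it.\<close>

lemma borel_probD:
  assumes "borel_prob M"
  shows "prob_space M" "sets M = sets borel" "space M = UNIV" "finite_measure M"
    "sigma_finite_measure M"
  using assms sets_eq_imp_space_eq[of M borel]
  by (auto simp: borel_prob_def prob_space_imp_sigma_finite prob_space.finite_measure)

lemma borel_prob_distr:
  assumes "prob_space P" "X \<in> measurable P borel"
  shows "borel_prob (distr P borel X)"
  using assms by (simp add: borel_prob_def prob_space.prob_space_distr)

lemma borel_prob_distr_borel:
  assumes "borel_prob M" "f \<in> measurable borel borel"
  shows "borel_prob (distr M borel f)"
  using assms borel_probD[OF assms(1)] by (intro borel_prob_distr) (auto cong: measurable_cong_sets)

lemma borel_prob_return: "borel_prob (return borel a)"
  by (simp add: borel_prob_def prob_space_return)

text \<open>This lets a convolution be read as the law of a sum on a product space, where almost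
  sure limits can be taken.\<close>

lemma convolution_distr_distr:
  fixes X Y :: "_ \<Rightarrow> 'a::ordered_euclidean_space"
  assumes "prob_space P" "prob_space Q"
    and [measurable]: "X \<in> borel_measurable P" "Y \<in> borel_measurable Q"
  shows "(distr P borel X \<star> distr Q borel Y) = distr (P \<Otimes>\<^sub>M Q) borel (\<lambda>(a, b). X a + Y b)"
proof -
  interpret P: prob_space P by fact
  interpret Q: prob_space Q by fact
  interpret Y: prob_space "distr Q borel Y" by (rule Q.prob_space_distr) simp
  have "(distr P borel X \<Otimes>\<^sub>M distr Q borel Y)
      = distr (P \<Otimes>\<^sub>M Q) (borel \<Otimes>\<^sub>M borel) (\<lambda>(a, b). (X a, Y b))"
    by (rule pair_measure_distr) (auto intro: Y.sigma_finite_measure)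
  then show ?thesis
    unfolding convolution_def by (simp add: distr_distr o_def case_prod_unfold)
qed

lemma distr_borel_ident: "sets M = sets borel \<Longrightarrow> distr M borel (\<lambda>x. x) = M"
  by (metis distr_id2)

lemma borel_prob_convolution:
  assumes "borel_prob M" "borel_prob N"
  shows "borel_prob (M \<star> N)"
proof -
  note [measurable_cong] = borel_probD(2)[OF assms(1)] borel_probD(2)[OF assms(2)]
  have "prob_space (M \<Otimes>\<^sub>M N)"
    using assms[THEN borel_probD(1)] by (rule prob_space_pair)
  then show ?thesis
    unfolding convolution_def by (rule borel_prob_distr) measurable
qed

lemma borel_prob_convolution_commute:
  assumes "borel_prob M" "borel_prob N"
  shows "(M \<star> N) = (N \<star> M)"
  using assms[THEN borel_probD(4)] assms[THEN borel_probD(2)] by (intro convolution_commutative)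

lemma borel_prob_convolution_assoc:
  assumes "borel_prob L" "borel_prob M" "borel_prob N"
  shows "((L \<star> M) \<star> N) = (L \<star> (M \<star> N))"
  using assms[THEN borel_probD(4)] assms[THEN borel_probD(2)]
  by (intro convolution_associative[symmetric])

lemma linear_borel_measurable:
  fixes f :: "'a::euclidean_space \<Rightarrow> 'b::real_normed_vector"
  assumes "linear f" shows "f \<in> borel_measurable borel"
  using assms by (intro borel_measurable_continuous_onI linear_continuous_on)
    (simp add: linear_conv_bounded_linear)

lemma distr_convolution:
  fixes f :: "'a::ordered_euclidean_space \<Rightarrow> 'a"
  assumes M: "borel_prob M" and N: "borel_prob N" and "linear f"
  shows "distr (M \<star> N) borel f = (distr M borel f \<star> distr N borel f)"
proof -
  note [measurable_cong] = borel_probD(2)[OF M] borel_probD(2)[OF N]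
  have [measurable]: "f \<in> borel_measurable borel"
    by (rule linear_borel_measurable[OF \<open>linear f\<close>])
  show ?thesis
    by (subst convolution_distr_distr)
      (auto simp: convolution_def distr_distr o_def case_prod_unfold linear_add[OF \<open>linear f\<close>]
         borel_probD(1)[OF M] borel_probD(1)[OF N])
qed

lemma convolution_return:
  fixes M :: "'a::ordered_euclidean_space measure"
  assumes M: "borel_prob M"
  shows "(M \<star> return borel a) = distr M borel (\<lambda>v. v + a)"
proof (rule measure_eqI)
  note [measurable_cong] = borel_probD(2)[OF M]
  fix A assume "A \<in> sets (M \<star> return borel a)"
  then have [measurable]: "A \<in> sets borel" by simp
  have "emeasure (M \<star> return borel a) A = (\<integral>\<^sup>+x. \<integral>\<^sup>+y. indicator A (x + y) \<partial>return borel a \<partial>M)"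
    using M borel_prob_return[of a] by (intro convolution_emeasure') (auto dest: borel_probD)
  also have "\<dots> = (\<integral>\<^sup>+x. indicator A (x + a) \<partial>M)"
    by (subst nn_integral_return) auto
  also have "\<dots> = (\<integral>\<^sup>+x. indicator ((\<lambda>v. v + a) -` A \<inter> space M) x \<partial>M)"
    by (intro nn_integral_cong) (auto split: split_indicator)
  also have "\<dots> = emeasure (distr M borel (\<lambda>v. v + a)) A"
    by (subst nn_integral_indicator) (auto simp: emeasure_distr)
  finally show "emeasure (M \<star> return borel a) A = emeasure (distr M borel (\<lambda>v. v + a)) A" .
qed simp

lemma convolution_return_0:
  fixes M :: "'a::ordered_euclidean_space measure"
  assumes M: "borel_prob M"
  shows "(M \<star> return borel 0) = M"
  using assms by (simp add: convolution_return distr_borel_ident borel_probD)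

lemma convolution_return_return:
  "(return borel a \<star> return borel b) = return borel (a + b :: 'a::ordered_euclidean_space)"
  by (subst convolution_return) (auto intro: borel_prob_return simp: distr_return)

text \<open>Closed sets form an intersection-stable generator, and the indicator of a closed set is
  the pointwise limit of the tent functions \<open>max 0 (1 - n * infdist x S)\<close>; dominated
  convergence then recovers its measure from integrals of bounded continuous functions.\<close>

lemma borel_prob_eqI:
  fixes M N :: "'a::metric_space measure"
  assumes M: "borel_prob M" and N: "borel_prob N"
    and eq: "\<And>f :: 'a \<Rightarrow> real. continuous_on UNIV f \<Longrightarrow> bounded (range f) \<Longrightarrow>
      integral\<^sup>L M f = integral\<^sup>L N f"
  shows "M = N"
proof (rule measure_eqI_generator_eq[where A = "\<lambda>_. UNIV"])
  show "Int_stable (Collect (closed :: 'a set \<Rightarrow> bool))"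
    by (auto simp: Int_stable_def)
  show "sets M = sigma_sets UNIV (Collect closed)" "sets N = sigma_sets UNIV (Collect closed)"
    using M N by (auto simp: borel_prob_def borel_eq_closed)
  show "emeasure M UNIV \<noteq> \<infinity>" for i :: nat
    using borel_probD[OF M] by (metis finite_measure.emeasure_finite infinity_ennreal_def)
  fix S :: "'a set" assume "S \<in> Collect closed"
  then have cl: "closed S" by simp
  define f :: "nat \<Rightarrow> 'a \<Rightarrow> real" where "f n x = max 0 (1 - real n * infdist x S)" for n x
  have cont: "continuous_on UNIV (f n)" for n
    unfolding f_def by (intro continuous_intros)
  have bd: "\<bar>f n x\<bar> \<le> 1" for n x
    unfolding f_def using infdist_nonneg[of x S] by (auto simp: max_def)
  then have bdd: "bounded (range (f n))" for n
    by (auto simp: bounded_iff)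
  \<comment> \<open>The value is a \<open>lim\<close> depending on \<open>L\<close> only through
    integrals, so one claim serves both measures. The empty set is excluded because
    \<open>infdist x {}\<close> is 0 by convention, which would make every \<open>f n\<close>
    constantly 1.\<close>
  have main: "emeasure L S = ennreal (lim (\<lambda>n. integral\<^sup>L L (f n)))"
    if "S \<noteq> {}" and L: "borel_prob L" for L
  proof -
    note [measurable_cong] = borel_probD(2)[OF L]
    interpret L: prob_space L by (rule borel_probD[OF L])
    have [measurable]: "f n \<in> borel_measurable borel" for n
      using cont by (rule borel_measurable_continuous_onI)
    have [measurable]: "S \<in> sets L" using cl borel_probD(2)[OF L] by auto
    have "(\<lambda>n. f n x) \<longlonglongrightarrow> indicator S x" for x
    proof (cases "x \<in> S")
      case True then show ?thesis by (simp add: f_def)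
    next
      case False
      then have "infdist x S > 0"
        using cl \<open>S \<noteq> {}\<close> infdist_pos_not_in_closed by blast
      then have "\<forall>\<^sub>F n in sequentially. real n > 1 / infdist x S"
        using filterlim_real_sequentially unfolding filterlim_at_top_dense by blast
      then have "\<forall>\<^sub>F n in sequentially. f n x = 0"
        by eventually_elim (use \<open>infdist x S > 0\<close> in \<open>auto simp: f_def field_simps\<close>)
      then show ?thesis using False by (simp add: tendsto_eventually)
    qed
    then have "(\<lambda>n. integral\<^sup>L L (f n)) \<longlonglongrightarrow> integral\<^sup>L L (indicator S)"
      by (intro integral_dominated_convergence[where w = "\<lambda>_. 1"])
        (use bd in auto)
    then have "lim (\<lambda>n. integral\<^sup>L L (f n)) = measure L S"
      using limI[of "\<lambda>n. integral\<^sup>L L (f n)" "measure L S"] by simp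
    then show ?thesis by (simp add: L.emeasure_eq_measure)
  qed
  show "emeasure M S = emeasure N S"
  proof (cases "S = {}")
    case False
    then show ?thesis using main[OF False M] main[OF False N] eq[OF cont bdd] by simp
  qed simp
qed (auto intro: exI[of _ UNIV])

lemma weakly_converges_unique:
  fixes N :: "'a::metric_space measure"
  assumes "weakly_converges M N" "weakly_converges M N'" "borel_prob N" "borel_prob N'"
  shows "N = N'"
  using assms unfolding weakly_converges_def
  by (intro borel_prob_eqI) (auto intro: LIMSEQ_unique)

text \<open>By dominated convergence. The weak limits of the development are obtained from almost
  sure limits on a suitable probability space.\<close>

lemma weakly_converges_distr:
  fixes X :: "nat \<Rightarrow> _ \<Rightarrow> 'a::{metric_space}"
  assumes "prob_space P" and [measurable]: "\<And>n. X n \<in> measurable P borel" "Y \<in> measurable P borel"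
    and lim: "AE \<omega> in P. (\<lambda>n. X n \<omega>) \<longlonglongrightarrow> Y \<omega>"
  shows "weakly_converges (\<lambda>n. distr P borel (X n)) (distr P borel Y)"
  unfolding weakly_converges_def
proof safe
  interpret prob_space P by fact
  fix f :: "'a \<Rightarrow> real" assume cont: "continuous_on UNIV f" and bd: "bounded (range f)"
  have [measurable]: "f \<in> borel_measurable borel"
    using cont by (rule borel_measurable_continuous_onI)
  obtain B where B: "\<And>x. \<bar>f x\<bar> \<le> B" using bd by (auto simp: bounded_iff)
  have "(\<lambda>n. \<integral>\<omega>. f (X n \<omega>) \<partial>P) \<longlonglongrightarrow> (\<integral>\<omega>. f (Y \<omega>) \<partial>P)"
  proof (rule integral_dominated_convergence[where w = "\<lambda>_. B"])
    show "AE \<omega> in P. (\<lambda>n. f (X n \<omega>)) \<longlonglongrightarrow> f (Y \<omega>)"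
      using lim by eventually_elim (use cont in \<open>auto intro: continuous_on_tendsto_compose\<close>)
  qed (use B in auto)
  then show "(\<lambda>n. integral\<^sup>L (distr P borel (X n)) f) \<longlonglongrightarrow> integral\<^sup>L (distr P borel Y) f"
    by (simp add: integral_distr)
qed

lemma weakly_converges_const: "weakly_converges (\<lambda>_. M) M"
  by (simp add: weakly_converges_def)

text \<open>The first half of Borel-Cantelli, which asks nothing about the joint law of the
  \<open>D n\<close>: almost surely all but finitely many terms are dominated by
  \<open>e n\<close>.\<close>

lemma AE_summable_of_tails:
  fixes D :: "nat \<Rightarrow> _ \<Rightarrow> 'a::{banach,second_countable_topology}"
  assumes [measurable]: "\<And>n. D n \<in> borel_measurable P"
    and fin: "(\<Sum>n. emeasure P {\<omega>\<in>space P. e n < norm (D n \<omega>)}) < \<infinity>"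
    and e: "summable e"
  shows "AE \<omega> in P. summable (\<lambda>n. D n \<omega>)"
proof -
  have "AE \<omega> in P. eventually (\<lambda>n. \<omega> \<in> space P - {\<omega>\<in>space P. e n < norm (D n \<omega>)}) sequentially"
  proof (rule borel_cantelli_AE1)
    show 1: "emeasure P {\<omega>\<in>space P. e n < norm (D n \<omega>)} < \<infinity>" for n
      using ennreal_suminf_lessD[OF fin[unfolded infinity_ennreal_def], of n] by simp
    show "summable (\<lambda>n. measure P {\<omega>\<in>space P. e n < norm (D n \<omega>)})"
      using fin 1 unfolding measure_def
      by (intro summable_suminf_not_top) (auto simp: less_top)
  qed measurable
  then show ?thesis
  proof eventually_elim
    case (elim \<omega>)
    then have "eventually (\<lambda>n. norm (D n \<omega>) \<le> e n) sequentially"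
      by eventually_elim auto
    then show ?case
      using e by (rule summable_comparison_test_ev)
  qed
qed

section \<open>Contraction rates and logarithmic moments\<close>

lemma linear_funpow:
  fixes \<phi> :: "'a::real_vector \<Rightarrow> 'a"
  assumes "linear \<phi>" shows "linear (\<phi> ^^ n)"
  using assms by (induction n) (auto simp: linear_id linear_compose id_def[symmetric])

lemma subspace_contraction_subspace:
  fixes \<phi> :: "'a::real_normed_vector \<Rightarrow> 'a"
  assumes "linear \<phi>" shows "subspace (contraction_subspace \<phi>)"
proof -
  have l: "linear (\<phi> ^^ n)" for n using assms by (rule linear_funpow)
  show ?thesis
    unfolding subspace_def contraction_subspace_def
    by (auto simp: linear_0[OF l] linear_add[OF l] linear_scale[OF l]
        intro: tendsto_add_zero tendsto_scaleR[of "\<lambda>_. _" _ _ _ 0, simplified])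
qed

lemma funpow_mem_contraction_subspace:
  assumes "v \<in> contraction_subspace \<phi>"
  shows "(\<phi> ^^ n) v \<in> contraction_subspace \<phi>"
proof -
  have "(\<lambda>k. (\<phi> ^^ (k + n)) v) \<longlonglongrightarrow> 0"
    using assms unfolding contraction_subspace_def by (auto intro: LIMSEQ_ignore_initial_segment)
  then show ?thesis by (simp add: contraction_subspace_def funpow_add)
qed

text \<open>Pointwise decay becomes uniform and geometric because the subspace is
  finite-dimensional: \<open>L n\<close>, a sum over an orthonormal basis, bounds the n-th iterate
  there and tends to 0. Once \<open>L N < 1/2\<close>, every block of N steps halves norms, since
  the subspace is invariant.\<close>

lemma contraction_subspace_rate:
  fixes \<phi> :: "'a::euclidean_space \<Rightarrow> 'a"
  assumes "linear \<phi>"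
  obtains K r where "0 \<le> K" "0 < r" "r < 1"
    "\<And>v n. v \<in> contraction_subspace \<phi> \<Longrightarrow> norm ((\<phi> ^^ n) v) \<le> K * r ^ n * norm v"
proof -
  let ?C = "contraction_subspace \<phi>"
  have lin: "linear (\<phi> ^^ n)" for n using assms by (rule linear_funpow)
  obtain B where B: "B \<subseteq> ?C" "pairwise orthogonal B" "\<And>x. x \<in> B \<Longrightarrow> norm x = 1"
    "independent B" "span B = ?C"
    using orthonormal_basis_subspace[OF subspace_contraction_subspace[OF assms]] by metis
  have finB: "finite B" using B(4) by (rule independent_imp_finite)
  define L where "L n = (\<Sum>b\<in>B. norm ((\<phi> ^^ n) b))" for n
  have L0: "0 \<le> L n" for n unfolding L_def by (intro sum_nonneg) auto
  have L: "norm ((\<phi> ^^ n) v) \<le> L n * norm v" if "v \<in> ?C" for n v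
  proof -
    have "v \<in> range (\<lambda>c. \<Sum>b\<in>B. c b *\<^sub>R b)"
      using that B(5) span_finite[OF finB] by simp
    then obtain c where c: "v = (\<Sum>b\<in>B. c b *\<^sub>R b)" by (rule rangeE)
    have "\<bar>c b\<bar> \<le> norm v" if "b \<in> B" for b
    proof -
      have "v \<bullet> b = (\<Sum>a\<in>B. c a * (a \<bullet> b))"
        unfolding c by (simp add: inner_sum_left)
      also have "\<dots> = (\<Sum>a\<in>B. if a = b then c b else 0)"
        using B(2,3) that by (intro sum.cong)
          (auto simp: pairwise_def orthogonal_def norm_eq_1)
      also have "\<dots> = c b" using finB that by simp
      finally show ?thesis
        using Cauchy_Schwarz_ineq2[of v b] B(3)[OF that] by simp
    qed
    then have "norm (\<Sum>b\<in>B. c b *\<^sub>R (\<phi> ^^ n) b) \<le> (\<Sum>b\<in>B. norm v * norm ((\<phi> ^^ n) b))"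
      by (intro sum_norm_le) (auto intro!: mult_right_mono)
    then show ?thesis
      unfolding c linear_sum[OF lin] linear_scale[OF lin]
      by (simp add: L_def sum_distrib_right mult.commute)
  qed
  have "L \<longlonglongrightarrow> (\<Sum>b\<in>B. norm (0::'a))"
    unfolding L_def using B(1)
    by (intro tendsto_sum tendsto_norm) (auto simp: contraction_subspace_def)
  then have "L \<longlonglongrightarrow> 0" by simp
  then have "eventually (\<lambda>n. L n < 1/2 \<and> n > 0) sequentially"
    by (intro eventually_conj order_tendstoD(2)[of L 0] eventually_gt_at_top) auto
  then obtain N where N: "L N < 1/2" "N > 0"
    by (auto simp: eventually_sequentially)
  \<comment> \<open>\<open>A\<close> bounds the incomplete block of \<open>n mod N\<close> steps,
    and \<open>r\<close> is the N-th root of 1/2.\<close>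
  define A where "A = (\<Sum>m<N. L m)"
  define r where "r = (1/2::real) powr (1 / N)"
  have half: "norm ((\<phi> ^^ (q * N)) v) \<le> (1/2) ^ q * norm v" if "v \<in> ?C" for q v
  proof (induction q)
    case (Suc q)
    have "norm ((\<phi> ^^ N) ((\<phi> ^^ (q * N)) v)) \<le> L N * norm ((\<phi> ^^ (q * N)) v)"
      using that by (intro L funpow_mem_contraction_subspace)
    also have "\<dots> \<le> 1/2 * ((1/2) ^ q * norm v)"
      using Suc N L0 by (intro mult_mono) auto
    finally show ?case by (simp add: funpow_add)
  qed simp
  show ?thesis
  proof (rule that[of "2 * A" r])
    show "0 \<le> 2 * A" unfolding A_def by (simp add: sum_nonneg L0)
    show "0 < r" unfolding r_def by simp
    show "r < 1" unfolding r_def using N powr_less_mono2[of "1 / N" "1/2" 1] by simp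
  next
    fix v n assume v: "v \<in> ?C"
    let ?q = "n div N" and ?m = "n mod N"
    have "(\<phi> ^^ n) v = (\<phi> ^^ (?q * N)) ((\<phi> ^^ ?m) v)"
      by (metis comp_apply div_mult_mod_eq funpow_add)
    then have "norm ((\<phi> ^^ n) v) \<le> (1/2) ^ ?q * norm ((\<phi> ^^ ?m) v)"
      using half[OF funpow_mem_contraction_subspace[OF v]] by simp
    also have "\<dots> \<le> (1/2) ^ ?q * (L ?m * norm v)"
      using L[OF v] by (intro mult_left_mono) auto
    also have "\<dots> \<le> (1/2) ^ ?q * (A * norm v)"
      unfolding A_def using N by (intro mult_left_mono mult_right_mono member_le_sum) (auto simp: L0)
    \<comment> \<open>Rounding n / N down costs at most one halving, hence the factor 2.\<close>
    also have "(1/2::real) ^ ?q \<le> 2 * r ^ n"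
    proof -
      have "n \<le> (?q + 1) * N"
        using dividend_less_div_times[of N n] N by (simp add: algebra_simps)
      then have "real n \<le> real ((?q + 1) * N)" by (rule of_nat_mono)
      then have "real n / N \<le> ?q + 1"
        using N by (simp add: divide_le_eq algebra_simps)
      then have "(1/2::real) powr (?q + 1) \<le> (1/2) powr (n / N)"
        by (intro powr_mono') auto
      also have "(1/2::real) powr (n / N) = r ^ n"
      proof -
        have "r ^ n = r powr real n" by (subst powr_realpow) (simp_all add: r_def)
        also have "\<dots> = (1/2) powr (n / N)" by (simp add: r_def powr_powr)
        finally show ?thesis ..
      qed
      also have "(1/2::real) powr (?q + 1) = (1/2) ^ ?q * (1/2)"
        by (subst powr_realpow) simp_all
      finally show ?thesis by simp
    qed
    then have "(1/2) ^ ?q * (A * norm v) \<le> 2 * r ^ n * (A * norm v)"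
      by (intro mult_right_mono) (auto simp: A_def sum_nonneg L0)
    finally show "norm ((\<phi> ^^ n) v) \<le> 2 * A * r ^ n * norm v"
      by (simp add: mult_ac)
  qed
qed

text \<open>Counts the powers of \<open>a\<close> below x. The 1 inside the logarithm keeps the
  bound meaningful for x < 1, the 1 outside accounts for the index 0.\<close>

lemma suminf_indicator_le:
  fixes a x :: real
  assumes "1 < a" "0 \<le> x"
  shows "(\<Sum>n. indicator {y. a ^ n < y} x :: ennreal) \<le> ennreal (1 + ln (x + 1) / ln a)"
proof -
  have pos: "0 \<le> ln (x + 1) / ln a" using assms by simp
  have "(\<Sum>i<n. indicator {y. a ^ i < y} x :: ennreal) \<le> ennreal (1 + ln (x + 1) / ln a)" for n
  proof -
    have sub: "{i\<in>{..<n}. a ^ i < x} \<subseteq> {..nat \<lfloor>ln (x + 1) / ln a\<rfloor>}"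
    proof safe
      fix i assume "a ^ i < x"
      then have "i * ln a \<le> ln (x + 1)"
        using assms by (subst ln_realpow[symmetric]) auto
      then have "real i \<le> ln (x + 1) / ln a" using assms by (simp add: field_simps)
      then show "i \<le> nat \<lfloor>ln (x + 1) / ln a\<rfloor>" by (simp add: le_nat_iff le_floor_iff)
    qed
    have "(\<Sum>i<n. indicator {y. a ^ i < y} x :: ennreal) = card {i\<in>{..<n}. a ^ i < x}"
      by (simp add: indicator_def sum.If_cases Int_def)
    also have "\<dots> \<le> of_nat (card {..nat \<lfloor>ln (x + 1) / ln a\<rfloor>})"
      using card_mono[OF _ sub] by (simp only: of_nat_le_iff) simp
    also have "\<dots> = ennreal (real (Suc (nat \<lfloor>ln (x + 1) / ln a\<rfloor>)))"
      by (simp only: card_atMost ennreal_of_nat_eq_real_of_nat)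
    also have "\<dots> \<le> ennreal (1 + ln (x + 1) / ln a)"
      using pos by (intro ennreal_leI) (simp add: of_nat_nat)
    finally show ?thesis .
  qed
  then show ?thesis unfolding suminf_eq_SUP by (rule SUP_least)
qed

text \<open>Tonelli: the sum of tails is the integral of the number of n with
  \<open>a ^ n < norm v\<close>.\<close>

lemma log_moment_tails:
  fixes M :: "'a::real_normed_vector measure"
  assumes M: "borel_prob M" and log: "log_moment_condition M" and "1 < a"
  shows "(\<Sum>n. emeasure M {v. a ^ n < norm v}) < \<infinity>"
proof -
  note [measurable_cong] = borel_probD(2)[OF M]
  interpret prob_space M by (rule borel_probD[OF M])
  have sp: "space M = UNIV" by (rule borel_probD[OF M])
  have [measurable]: "{v. a ^ n < norm v} \<in> sets M" for n
  proof -
    have "{v\<in>space M. a ^ n < norm v} \<in> sets M" by measurable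
    then show ?thesis by (simp add: sp)
  qed
  have "(\<Sum>n. emeasure M {v. a ^ n < norm v})
      = (\<Sum>n. \<integral>\<^sup>+v. indicator {y. a ^ n < y} (norm v) \<partial>M)"
    by (intro suminf_cong, subst nn_integral_indicator[symmetric])
      (auto intro!: nn_integral_cong simp: indicator_def simp del: nn_integral_indicator)
  also have "\<dots> = (\<integral>\<^sup>+v. (\<Sum>n. indicator {y. a ^ n < y} (norm v)) \<partial>M)"
    by (rule nn_integral_suminf[symmetric]) measurable
  also have "\<dots> \<le> (\<integral>\<^sup>+v. ennreal (1 + ln (norm v + 1) / ln a) \<partial>M)"
    using \<open>1 < a\<close> by (intro nn_integral_mono suminf_indicator_le) auto
  also have "\<dots> = (\<integral>\<^sup>+v. 1 + ennreal (1 / ln a) * ennreal (ln (norm v + 1)) \<partial>M)"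
    using \<open>1 < a\<close> by (intro nn_integral_cong) (simp add: ennreal_mult''[symmetric])
  also have "\<dots> = 1 + ennreal (1 / ln a) * (\<integral>\<^sup>+v. ennreal (ln (norm v + 1)) \<partial>M)"
    by (simp add: nn_integral_add nn_integral_cmult emeasure_space_1)
  also have "\<dots> < \<infinity>"
    using log by (auto simp: log_moment_condition_def ennreal_mult_less_top)
  finally show ?thesis .
qed

text \<open>The rate \<open>r ^ n\<close> is split into two factors \<open>sqrt r ^ n\<close>: one
  absorbs a norm of v up to \<open>a ^ n\<close> with \<open>a = 1 / sqrt r\<close>, the other keeps
  the remaining bound summable.\<close>

lemma summable_iterate_tails:
  fixes \<phi> :: "'a::euclidean_space \<Rightarrow> 'a"
  assumes "linear \<phi>" and M: "borel_prob M" and log: "log_moment_condition M"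
    and supp: "AE v in M. v \<in> contraction_subspace \<phi>"
  obtains e where "summable e" "(\<Sum>n. emeasure M {v. e n < norm ((\<phi> ^^ n) v)}) < \<infinity>"
proof -
  note [measurable_cong] = borel_probD(2)[OF M]
  have sp: "space M = UNIV" by (rule borel_probD[OF M])
  have [measurable]: "\<phi> ^^ n \<in> borel_measurable borel" for n
    by (rule linear_borel_measurable[OF linear_funpow[OF \<open>linear \<phi>\<close>]])
  obtain K r where K: "0 \<le> K" and r: "0 < r" "r < 1" and
    rate: "\<And>v n. v \<in> contraction_subspace \<phi> \<Longrightarrow> norm ((\<phi> ^^ n) v) \<le> K * r ^ n * norm v"
    using contraction_subspace_rate[OF \<open>linear \<phi>\<close>] by metis
  define a where "a = 1 / sqrt r"
  have a: "1 < a" using r by (simp add: a_def)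
  have ra: "r ^ n * a ^ n = sqrt r ^ n" for n
    using r by (simp add: a_def power_mult_distrib[symmetric] real_div_sqrt)
  show ?thesis
  proof (rule that[of "\<lambda>n. K * sqrt r ^ n"])
    show "summable (\<lambda>n. K * sqrt r ^ n)"
      using r by (intro summable_mult summable_geometric) simp
    have "emeasure M {v. K * sqrt r ^ n < norm ((\<phi> ^^ n) v)} \<le> emeasure M {v. a ^ n < norm v}" for n
    proof (rule emeasure_mono_AE)
      show "AE v in M. v \<in> {v. K * sqrt r ^ n < norm ((\<phi> ^^ n) v)} \<longrightarrow> v \<in> {v. a ^ n < norm v}"
        using supp
      proof eventually_elim
        case (elim v)
        show ?case
        proof safe
          assume less: "K * sqrt r ^ n < norm ((\<phi> ^^ n) v)"
          show "a ^ n < norm v"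
          proof (rule ccontr)
            assume "\<not> a ^ n < norm v"
            then have "K * r ^ n * norm v \<le> K * r ^ n * a ^ n"
              using K r by (intro mult_left_mono) auto
            with less rate[OF elim, of n] ra[of n] show False by (simp add: mult.assoc)
          qed
        qed
      qed
      have "{v\<in>space M. a ^ n < norm v} \<in> sets M" by measurable
      then show "{v. a ^ n < norm v} \<in> sets M" by (simp add: sp)
    qed
    then have "(\<Sum>n. emeasure M {v. K * sqrt r ^ n < norm ((\<phi> ^^ n) v)})
        \<le> (\<Sum>n. emeasure M {v. a ^ n < norm v})"
      by (intro suminf_le) auto
    also have "\<dots> < \<infinity>" using M log a by (rule log_moment_tails)
    finally show "(\<Sum>n. emeasure M {v. K * sqrt r ^ n < norm ((\<phi> ^^ n) v)}) < \<infinity>" .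
  qed
qed

text \<open>Counterpart of \<open>suminf_indicator_le\<close>: for x > 1 every index i up to ln x /
  ln (1/c) has \<open>1 \<le> c ^ i * x\<close>. The summand ln 2 covers x \<le> 1 and otherwise
  pays for replacing x + 1 by 2 x.\<close>

lemma ln_le_suminf_indicator:
  fixes c x :: real and y :: "nat \<Rightarrow> real"
  assumes c: "0 < c" "c < 1" and "0 \<le> x" and y: "\<And>i. c ^ i * x \<le> y i"
  shows "ennreal (ln (x + 1)) \<le> ennreal (ln 2) + ennreal (ln (1 / c)) * (\<Sum>i. indicator {1..} (y i))"
proof (cases "x \<le> 1")
  case True
  then have "ennreal (ln (x + 1)) \<le> ennreal (ln 2)"
    using \<open>0 \<le> x\<close> by (intro ennreal_leI) auto
  then show ?thesis by (rule order_trans) simp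
next
  case False
  define m where "m = nat \<lfloor>ln x / ln (1 / c)\<rfloor>"
  have lc: "0 < ln (1 / c)" using c by simp
  have lx: "0 \<le> ln x / ln (1 / c)" using False lc by simp
  have "1 \<le> y i" if "i \<le> m" for i
  proof -
    have "real i \<le> ln x / ln (1 / c)" using that lx unfolding m_def by linarith
    then have "i * ln (1 / c) \<le> ln x" using lc by (simp add: field_simps)
    then have "0 \<le> ln (c ^ i * x)"
      using c False by (simp add: ln_mult ln_realpow ln_div)
    moreover have "0 < c ^ i * x" using c False by simp
    ultimately have "1 \<le> c ^ i * x" by (simp only: ln_ge_zero_iff)
    with y[of i] show ?thesis by simp
  qed
  then have "(\<Sum>i\<le>m. indicator {1..} (y i) :: ennreal) = (\<Sum>i\<le>m. 1)"
    by (intro sum.cong) (auto simp: indicator_def)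
  then have le: "ennreal (real (Suc m)) \<le> (\<Sum>i. indicator {1..} (y i))"
    using sum_le_suminf[of "\<lambda>i. indicator {1..} (y i) :: ennreal" "{..m}"]
    by (simp add: ennreal_of_nat_eq_real_of_nat)
  \<comment> \<open>Rounding down in \<open>m\<close> loses nothing, because the index 0 counts too
    and gives m + 1 good indices.\<close>
  have "ln x / ln (1 / c) \<le> Suc m" using lx unfolding m_def by linarith
  then have "ln x \<le> ln (1 / c) * Suc m" using lc by (simp add: field_simps)
  moreover have "ln (x + 1) \<le> ln (2 * x)" using False by simp
  ultimately have "ln (x + 1) \<le> ln 2 + ln (1 / c) * Suc m" using False by (simp add: ln_mult)
  then have "ennreal (ln (x + 1)) \<le> ennreal (ln 2 + ln (1 / c) * Suc m)" by (rule ennreal_leI)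
  also have "\<dots> = ennreal (ln 2) + ennreal (ln (1 / c)) * ennreal (Suc m)"
    using lc by (subst ennreal_plus) (auto simp: ennreal_mult simp del: of_nat_Suc)
  also have "\<dots> \<le> ennreal (ln 2) + ennreal (ln (1 / c)) * (\<Sum>i. indicator {1..} (y i))"
    using le by (intro add_left_mono mult_left_mono) auto
  finally show ?thesis .
qed

lemma funpow_norm_ge:
  fixes \<phi> :: "'a::euclidean_space \<Rightarrow> 'a"
  assumes "linear \<phi>" "inj \<phi>"
  obtains c where "0 < c" "c < 1" "\<And>v n. c ^ n * norm v \<le> norm ((\<phi> ^^ n) v)"
proof -
  obtain B where B: "B > 0" "\<And>x. B * norm x \<le> norm (\<phi> x)"
    using linear_inj_bounded_below_pos[OF assms] by metis
  \<comment> \<open>The cap 1/2 forces c < 1, so that \<open>ln (1 / c)\<close> is positive when the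
    indices are counted.\<close>
  define c where "c = min B (1/2)"
  have c: "0 < c" "c < 1" and cB: "c \<le> B" using B by (auto simp: c_def)
  have step: "c * norm x \<le> norm (\<phi> x)" for x
    using B(2)[of x] mult_right_mono[OF cB norm_ge_zero[of x]] by linarith
  have "c ^ n * norm v \<le> norm ((\<phi> ^^ n) v)" for v n
  proof (induction n)
    case (Suc n)
    have "c * (c ^ n * norm v) \<le> c * norm ((\<phi> ^^ n) v)"
      using Suc c by (intro mult_left_mono) auto
    also have "\<dots> \<le> norm ((\<phi> ^^ Suc n) v)" using step by simp
    finally show ?case by (simp add: mult.assoc)
  qed simp
  with c show ?thesis by (intro that)
qed

section \<open>Almost sure realizations\<close>

text \<open>The law of the sum of \<phi>^i(Z_i) over i < n for independent Z_i of law
  \<open>\<sigma>\<close>. The new term enters untransformed while the old sum is pushed through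
  \<open>\<phi>\<close>, so the recursion has the shape of (E).\<close>

primrec discounted_sum_law ::
    "('a::ordered_euclidean_space \<Rightarrow> 'a) \<Rightarrow> 'a measure \<Rightarrow> nat \<Rightarrow> 'a measure" where
  "discounted_sum_law \<phi> \<sigma> 0 = return borel 0"
| "discounted_sum_law \<phi> \<sigma> (Suc n) = (\<sigma> \<star> distr (discounted_sum_law \<phi> \<sigma> n) borel \<phi>)"

section \<open>Product spaces and almost sure convergence of the discounted sums\<close>

lemma AE_pair_fst:
  assumes "prob_space P" "prob_space Q" "AE x in P. A x"
  shows "AE z in P \<Otimes>\<^sub>M Q. A (fst z)"
proof -
  interpret Q: prob_space Q by fact
  have "AE x in distr (P \<Otimes>\<^sub>M Q) P fst. A x"
    using assms(3) by (simp only: Q.distr_pair_fst)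
  then show ?thesis by (rule AE_distrD[OF measurable_fst])
qed

lemma distr_pair_snd:
  assumes "prob_space P" "prob_space Q"
  shows "distr (P \<Otimes>\<^sub>M Q) Q snd = Q"
proof -
  interpret P: prob_space P by fact
  interpret Q: prob_space Q by fact
  interpret PQ: pair_sigma_finite P Q ..
  have "distr (P \<Otimes>\<^sub>M Q) Q snd = distr (distr (Q \<Otimes>\<^sub>M P) (P \<Otimes>\<^sub>M Q) (\<lambda>(x, y). (y, x))) Q snd"
    using PQ.distr_pair_swap by simp
  also have "\<dots> = distr (Q \<Otimes>\<^sub>M P) Q fst"
    by (subst distr_distr) (auto intro!: arg_cong2[where f = "distr (Q \<Otimes>\<^sub>M P)"] simp: o_def)
  also have "\<dots> = Q" by (rule P.distr_pair_fst)
  finally show ?thesis .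
qed

lemma AE_pair_snd:
  assumes "prob_space P" "prob_space Q" "AE x in Q. A x"
  shows "AE z in P \<Otimes>\<^sub>M Q. A (snd z)"
proof -
  have "AE x in distr (P \<Otimes>\<^sub>M Q) Q snd. A x"
    using assms(3) by (simp only: distr_pair_snd[OF assms(1,2)])
  then show ?thesis by (rule AE_distrD[OF measurable_snd])
qed

text \<open>On the product of independent copies, summable tails give almost sure convergence.
  Prepending an independent coordinate s preserves the product law and represents X_{n+1} as s +
  \<phi>(X_n); in the limit this becomes the fixed point equation for the law of Y.\<close>

lemma discounted_sum_converges:
  fixes \<phi> :: "'a::ordered_euclidean_space \<Rightarrow> 'a"
  assumes lin: "linear \<phi>" and \<sigma>: "borel_prob \<sigma>" and log: "log_moment_condition \<sigma>"
    and supp: "AE v in \<sigma>. v \<in> contraction_subspace \<phi>"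
  obtains S :: "(nat \<Rightarrow> 'a) measure" and X Y where "prob_space S"
    "\<And>n. X n \<in> borel_measurable S" "Y \<in> borel_measurable S"
    "\<And>n. distr S borel (X n) = discounted_sum_law \<phi> \<sigma> n"
    "AE \<omega> in S. (\<lambda>n. X n \<omega>) \<longlonglongrightarrow> Y \<omega>"
    "distr S borel Y = (\<sigma> \<star> distr (distr S borel Y) borel \<phi>)"
    "AE \<omega> in S. Y \<omega> \<in> contraction_subspace \<phi>"
proof -
  note [measurable_cong] = borel_probD(2)[OF \<sigma>]
  interpret \<sigma>: prob_space \<sigma> by (rule borel_probD[OF \<sigma>])
  interpret sequence_space \<sigma> ..
  have lin_pow: "linear (\<phi> ^^ n)" for n by (rule linear_funpow[OF lin])
  note [measurable] = linear_borel_measurable[OF lin_pow] linear_borel_measurable[OF lin]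
  have S: "prob_space S" by (rule prob_space_PiM) (rule \<sigma>.prob_space_axioms)
  have coord: "distr S \<sigma> (\<lambda>\<omega>. \<omega> n) = \<sigma>" for n by (rule PiM_component) simp
  define X where "X n \<omega> = (\<Sum>i<n. (\<phi> ^^ i) (\<omega> i))" for n and \<omega> :: "nat \<Rightarrow> 'a"
  \<comment> \<open>Where \<open>X n\<close> diverges, the value of \<open>Lim\<close> is
    unspecified; this affects a null set only.\<close>
  define Y where "Y \<omega> = Lim sequentially (\<lambda>n. X n \<omega>)" for \<omega>
  have X_meas [measurable]: "X n \<in> borel_measurable S" for n unfolding X_def by measurable
  have Y_meas [measurable]: "Y \<in> borel_measurable S" unfolding Y_def by measurable
  have X_Suc: "X (Suc n) (case_nat s \<omega>) = s + \<phi> (X n \<omega>)" for n s \<omega>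
    unfolding X_def sum.lessThan_Suc_shift by (simp add: linear_sum[OF lin])
  have conv_distr: "distr (\<sigma> \<Otimes>\<^sub>M S) borel (\<lambda>(s, \<omega>). s + \<phi> (Z \<omega>))
      = (\<sigma> \<star> distr (distr S borel Z) borel \<phi>)" if [measurable]: "Z \<in> borel_measurable S" for Z
    using convolution_distr_distr[OF \<sigma>.prob_space_axioms S, of "\<lambda>s. s" "\<lambda>\<omega>. \<phi> (Z \<omega>)"]
    by (simp add: distr_distr o_def distr_borel_ident[OF borel_probD(2)[OF \<sigma>]])
  have law_Suc: "distr S borel (X (Suc n)) = distr (\<sigma> \<Otimes>\<^sub>M S) borel (\<lambda>(s, \<omega>). s + \<phi> (X n \<omega>))" for n
  proof -
    have "distr S borel (X (Suc n)) = distr (distr (\<sigma> \<Otimes>\<^sub>M S) S (\<lambda>(s, \<omega>). case_nat s \<omega>)) borel (X (Suc n))"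
      by (simp only: PiM_iter)
    also have "\<dots> = distr (\<sigma> \<Otimes>\<^sub>M S) borel (\<lambda>(s, \<omega>). s + \<phi> (X n \<omega>))"
      by (subst distr_distr) (auto simp: o_def case_prod_unfold X_Suc)
    finally show ?thesis .
  qed
  have law: "distr S borel (X n) = discounted_sum_law \<phi> \<sigma> n" for n
  proof (induction n)
    case 0
    show ?case using prob_space.distr_const[OF S, of 0 borel] by (simp add: X_def[abs_def])
  next
    case (Suc n)
    then show ?case by (simp only: law_Suc conv_distr[OF X_meas] discounted_sum_law.simps)
  qed
  obtain e where e: "summable e" and tails: "(\<Sum>n. emeasure \<sigma> {v. e n < norm ((\<phi> ^^ n) v)}) < \<infinity>"
    by (rule summable_iterate_tails[OF lin \<sigma> log supp])
  have sp: "space \<sigma> = UNIV" by (rule borel_probD[OF \<sigma>])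
  have "emeasure S {\<omega>\<in>space S. e n < norm ((\<phi> ^^ n) (\<omega> n))}
      = emeasure \<sigma> {v. e n < norm ((\<phi> ^^ n) v)}" for n
  proof -
    have m: "{v\<in>space \<sigma>. e n < norm ((\<phi> ^^ n) v)} \<in> sets \<sigma>" by measurable
    have "emeasure \<sigma> {v\<in>space \<sigma>. e n < norm ((\<phi> ^^ n) v)}
        = emeasure (distr S \<sigma> (\<lambda>\<omega>. \<omega> n)) {v\<in>space \<sigma>. e n < norm ((\<phi> ^^ n) v)}"
      by (simp only: coord)
    also have "\<dots> = emeasure S {\<omega>\<in>space S. e n < norm ((\<phi> ^^ n) (\<omega> n))}"
      using m by (subst emeasure_distr) (auto intro!: arg_cong[where f = "emeasure S"] simp: space_PiM sp)
    finally show ?thesis by (simp add: sp)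
  qed
  then have "AE \<omega> in S. summable (\<lambda>n. (\<phi> ^^ n) (\<omega> n))"
    using tails e by (intro AE_summable_of_tails[where e = e]) auto
  then have lim: "AE \<omega> in S. (\<lambda>n. X n \<omega>) \<longlonglongrightarrow> Y \<omega>"
    unfolding Y_def X_def by eventually_elim (metis summable_LIMSEQ convergent_LIMSEQ_iff convergentI)
  \<comment> \<open>One sequence of laws gets two weak limits, directly and through the prepended
    coordinate; uniqueness equates them.\<close>
  have "weakly_converges (\<lambda>n. distr S borel (X (Suc n))) (distr S borel Y)"
    using lim by (intro weakly_converges_distr S) (auto elim!: eventually_mono intro: LIMSEQ_Suc)
  moreover have "weakly_converges (\<lambda>n. distr S borel (X (Suc n))) (\<sigma> \<star> distr (distr S borel Y) borel \<phi>)"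
  proof -
    have "AE z in \<sigma> \<Otimes>\<^sub>M S. (\<lambda>n. X n (snd z)) \<longlonglongrightarrow> Y (snd z)"
      by (rule AE_pair_snd[OF \<sigma>.prob_space_axioms S lim])
    then have "AE z in \<sigma> \<Otimes>\<^sub>M S. (\<lambda>n. case z of (s, \<omega>) \<Rightarrow> s + \<phi> (X n \<omega>)) \<longlonglongrightarrow> (case z of (s, \<omega>) \<Rightarrow> s + \<phi> (Y \<omega>))"
    proof eventually_elim
      case (elim z)
      have "bounded_linear \<phi>" using lin by (simp add: linear_conv_bounded_linear)
      then show ?case
        unfolding case_prod_unfold
        by (rule tendsto_add[OF tendsto_const bounded_linear.tendsto[OF _ elim]])
    qed
    then show ?thesis
      unfolding law_Suc conv_distr[OF Y_meas, symmetric]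
      by (intro weakly_converges_distr[OF prob_space_pair[OF \<sigma>.prob_space_axioms S]]) auto
  qed
  ultimately have inv: "distr S borel Y = (\<sigma> \<star> distr (distr S borel Y) borel \<phi>)"
    by (rule weakly_converges_unique[OF _ _ borel_prob_distr[OF S Y_meas]
          borel_prob_convolution[OF \<sigma> borel_prob_distr_borel[OF borel_prob_distr[OF S Y_meas]]]])
      (rule linear_borel_measurable[OF lin])
  \<comment> \<open>A subspace of a finite-dimensional space is closed, so the limit stays in it
    together with the partial sums.\<close>
  have sub: "subspace (contraction_subspace \<phi>)" using lin by (rule subspace_contraction_subspace)
  have "AE \<omega> in S. \<forall>n. \<omega> n \<in> contraction_subspace \<phi>"
    using AE_PiM_component[where M = "\<lambda>_. \<sigma>" and I = "UNIV :: nat set", OF _ _ supp] \<sigma>.prob_space_axioms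
    unfolding AE_all_countable by simp
  with lim have "AE \<omega> in S. Y \<omega> \<in> contraction_subspace \<phi>"
  proof eventually_elim
    case (elim \<omega>)
    have "X n \<omega> \<in> contraction_subspace \<phi>" for n
      unfolding X_def using elim(2) by (intro subspace_sum[OF sub] funpow_mem_contraction_subspace) auto
    then show ?case
      by (rule closed_sequentially[OF closed_subspace[OF sub] _ elim(1)])
  qed
  with S X_meas Y_meas law lim inv show ?thesis by (rule that)
qed

text \<open>The joint law of \<open>V\<^sub>j, \<dots>, V\<^sub>j\<^sub>+\<^sub>m\<close> in a chain with \<open>V\<^sub>i = D\<^sub>i + V\<^sub>i\<^sub>+\<^sub>1\<close> and \<open>D\<^sub>i\<close> of law \<open>\<tau> i\<close>
  independent of the later variables, encoded on infinite sequences that are constant from index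
  \<open>m\<close> on.\<close>

primrec backward_chain_law :: "(nat \<Rightarrow> 'a::ordered_euclidean_space measure) \<Rightarrow> (nat \<Rightarrow> 'a measure) \<Rightarrow>
    nat \<Rightarrow> nat \<Rightarrow> (nat \<Rightarrow> 'a) measure" where
  "backward_chain_law R \<tau> 0 j = distr (R j) (PiM UNIV (\<lambda>_. borel)) (\<lambda>x _. x)"
| "backward_chain_law R \<tau> (Suc m) j =
    distr (\<tau> j \<Otimes>\<^sub>M backward_chain_law R \<tau> m (Suc j)) (PiM UNIV (\<lambda>_. borel))
      (\<lambda>(d, v). case_nat (d + v 0) v)"

text \<open>Each variable is a fresh increment plus its successor, and there is no last variable to
  start from. Explicit joint laws therefore exist only up to a finite horizon. Hypothesis
  \<open>step\<close> makes them consistent as the horizon moves, so that Kolmogorov's theorem can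
  glue them.\<close>

lemma backward_coupling:
  fixes R \<tau> :: "nat \<Rightarrow> 'a::ordered_euclidean_space measure"
  assumes R: "\<And>n. borel_prob (R n)" and \<tau>: "\<And>n. borel_prob (\<tau> n)"
    and step: "\<And>n. R n = (\<tau> n \<star> R (Suc n))"
  obtains S :: "(nat \<Rightarrow> 'a) measure" where "prob_space S" "sets S = sets (PiM UNIV (\<lambda>_. borel))"
    "\<And>n. distr S borel (\<lambda>v. v n) = R n"
    "\<And>n. distr S borel (\<lambda>v. v n - v (Suc n)) = \<tau> n"
proof -
  let ?PM = "PiM UNIV (\<lambda>_. borel) :: (nat \<Rightarrow> 'a) measure"
  define K where "K = backward_chain_law R \<tau>"
  \<comment> \<open>\<open>t m\<close> freezes a sequence at index m; it compares different horizons
    while all laws live on one sequence space.\<close>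
  define t where "t m v = (\<lambda>i. v (min i m))" for m :: nat and v :: "nat \<Rightarrow> 'a"
  have sets_R [measurable_cong]: "sets (R n) = sets borel" and sets_tau [measurable_cong]: "sets (\<tau> n) = sets borel" for n
    by (rule borel_probD[OF R], rule borel_probD[OF \<tau>])
  have sets_K [measurable_cong]: "sets (K m j) = sets ?PM" for m j
    by (cases m) (simp_all add: K_def)
  have t_meas [measurable]: "t m \<in> measurable ?PM ?PM" for m
    unfolding t_def by (rule measurable_PiM_single') auto
  have const_meas: "(\<lambda>x _. x) \<in> measurable borel ?PM"
    by (rule measurable_PiM_single') auto
  have const_R: "(\<lambda>x _. x) \<in> measurable (R j) ?PM" for j
    using const_meas measurable_cong_sets[OF borel_probD(2)[OF R] refl] by blast
  have step_meas [measurable]: "(\<lambda>(d, v). case_nat (d + v 0) v) \<in> measurable (borel \<Otimes>\<^sub>M ?PM) ?PM"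
    unfolding case_prod_unfold by measurable
  have K_Suc: "K (Suc m) j = distr (\<tau> j \<Otimes>\<^sub>M K m (Suc j)) ?PM (\<lambda>(d, v). case_nat (d + v 0) v)" for m j
    by (simp add: K_def)
  have prob_K: "prob_space (K m j)" for m j
  proof (induction m arbitrary: j)
    case 0
    show ?case unfolding K_def backward_chain_law.simps
      by (rule prob_space.prob_space_distr[OF borel_probD(1)[OF R] const_R])
  next
    case (Suc m)
    have "prob_space (\<tau> j \<Otimes>\<^sub>M K m (Suc j))"
      by (rule prob_space_pair[OF borel_probD(1)[OF \<tau>] Suc])
    then show ?case unfolding K_Suc by (rule prob_space.prob_space_distr) measurable
  qed
  have distr_K_Suc: "distr (K (Suc m) j) N f
      = distr (\<tau> j \<Otimes>\<^sub>M K m (Suc j)) N (\<lambda>z. f (case_nat (fst z + snd z 0) (snd z)))"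
    if "f \<in> measurable ?PM N" for f m j and N :: "'b measure"
    unfolding K_Suc using that by (subst distr_distr) (auto simp: o_def case_prod_unfold)
  have snd_law: "distr (\<tau> j \<Otimes>\<^sub>M K m (Suc j)) N (\<lambda>z. f (snd z)) = distr (K m (Suc j)) N f"
    if [measurable]: "f \<in> measurable ?PM N" for f m j and N :: "'b measure"
    using distr_distr[of f "K m (Suc j)" N snd "\<tau> j \<Otimes>\<^sub>M K m (Suc j)"]
      distr_pair_snd[OF borel_probD(1)[OF \<tau>] prob_K] by (simp add: o_def)
  \<comment> \<open>The first coordinate of the extended chain has law
    \<open>\<tau> j \<star> R (Suc j)\<close>, which \<open>step\<close> identifies with
    \<open>R j\<close>.\<close>
  have law0: "distr (\<tau> j \<Otimes>\<^sub>M K m (Suc j)) borel (\<lambda>z. fst z + snd z 0) = R j"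
    if "distr (K m (Suc j)) borel (\<lambda>v. v 0) = R (Suc j)" for m j
  proof -
    have 1: "(\<lambda>d. d) \<in> borel_measurable (\<tau> j)"
      by (rule measurable_ident_sets) (rule borel_probD(2)[OF \<tau>])
    have 2: "(\<lambda>v. v 0) \<in> borel_measurable (K m (Suc j))" by measurable
    have "(distr (\<tau> j) borel (\<lambda>d. d) \<star> distr (K m (Suc j)) borel (\<lambda>v. v 0))
        = distr (\<tau> j \<Otimes>\<^sub>M K m (Suc j)) borel (\<lambda>(d, v). d + v 0)"
      by (rule convolution_distr_distr[OF borel_probD(1)[OF \<tau>] prob_K 1 2])
    then show ?thesis
      by (simp only: that distr_borel_ident[OF borel_probD(2)[OF \<tau>]] step[symmetric] case_prod_unfold)
  qed
  have marg: "distr (K m j) borel (\<lambda>v. v i) = R (j + i)" if "i \<le> m" for i m j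
    using that
  proof (induction m arbitrary: i j)
    case 0
    have "distr (K 0 j) borel (\<lambda>v. v 0) = distr (R j) borel (\<lambda>x. x)"
      unfolding K_def backward_chain_law.simps
      by (subst distr_distr[OF _ const_R]) (simp_all add: o_def)
    with 0 show ?case by (simp add: distr_borel_ident[OF sets_R])
  next
    case (Suc m)
    show ?case
    proof (cases i)
      case 0
      then show ?thesis using Suc.IH[of 0 "Suc j"] by (simp add: distr_K_Suc law0)
    next
      case (Suc i')
      then show ?thesis using Suc.IH[of i' "Suc j"] Suc.prems
        by (simp add: distr_K_Suc snd_law[of "\<lambda>v. v i'"])
    qed
  qed
  have incr: "distr (K m j) borel (\<lambda>v. v i - v (Suc i)) = \<tau> (j + i)" if "i < m" for i m j
    using that
  proof (induction m arbitrary: i j)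
    case (Suc m)
    show ?case
    proof (cases i)
      case 0
      interpret K: prob_space "K m (Suc j)" by (rule prob_K)
      have "distr (\<tau> j \<Otimes>\<^sub>M K m (Suc j)) borel fst = distr (\<tau> j \<Otimes>\<^sub>M K m (Suc j)) (\<tau> j) fst"
        by (intro distr_cong) (simp_all add: borel_probD(2)[OF \<tau>])
      also have "\<dots> = \<tau> j" by (rule K.distr_pair_fst)
      finally show ?thesis using 0 by (simp add: distr_K_Suc)
    next
      case (Suc i')
      then show ?thesis using Suc.IH[of i' "Suc j"] Suc.prems
        by (simp add: distr_K_Suc snd_law[of "\<lambda>v. v i' - v (Suc i')"])
    qed
  qed simp
  \<comment> \<open>Freezing a sequence at index \<open>m\<close> commutes with prepending a step, which yields consistency.\<close>
  have trunc1: "distr (K (Suc m) j) ?PM (t m) = K m j" for m j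
  proof (induction m arbitrary: j)
    case 0
    have "distr (K (Suc 0) j) ?PM (t 0) = distr (\<tau> j \<Otimes>\<^sub>M K 0 (Suc j)) ?PM (\<lambda>z _. fst z + snd z 0)"
      by (simp add: distr_K_Suc) (simp add: t_def)
    also have "\<dots> = distr (distr (\<tau> j \<Otimes>\<^sub>M K 0 (Suc j)) borel (\<lambda>z. fst z + snd z 0)) ?PM (\<lambda>x _. x)"
      by (subst distr_distr[OF const_meas]) (auto simp: o_def)
    also have "\<dots> = distr (R j) ?PM (\<lambda>x _. x)"
      using marg[of 0 0 "Suc j"] by (simp add: law0)
    finally show ?case by (simp add: K_def)
  next
    case (Suc m)
    have t_Suc: "t (Suc m) (case_nat a v) = case_nat a (t m v)" "t m v 0 = v 0" for a v
      by (auto simp: t_def fun_eq_iff split: nat.split)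
    interpret K: prob_space "K m (Suc j)" by (rule prob_K)
    have "distr (K (Suc (Suc m)) j) ?PM (t (Suc m))
        = distr (\<tau> j \<Otimes>\<^sub>M K (Suc m) (Suc j)) ?PM (\<lambda>z. case_nat (fst z + t m (snd z) 0) (t m (snd z)))"
      by (simp add: distr_K_Suc t_Suc)
    also have "\<dots> = distr (distr (\<tau> j \<Otimes>\<^sub>M K (Suc m) (Suc j)) (\<tau> j \<Otimes>\<^sub>M ?PM) (\<lambda>(d, v). (d, t m v)))
        ?PM (\<lambda>(d, v). case_nat (d + v 0) v)"
      by (subst distr_distr) (auto simp: o_def case_prod_unfold)
    also have "distr (\<tau> j \<Otimes>\<^sub>M K (Suc m) (Suc j)) (\<tau> j \<Otimes>\<^sub>M ?PM) (\<lambda>(d, v). (d, t m v))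
        = distr (\<tau> j) (\<tau> j) (\<lambda>d. d) \<Otimes>\<^sub>M distr (K (Suc m) (Suc j)) ?PM (t m)"
      by (rule pair_measure_distr[symmetric]) (auto simp: Suc K.sigma_finite_measure)
    also have "\<dots> = \<tau> j \<Otimes>\<^sub>M K m (Suc j)" by (simp add: Suc distr_id)
    finally show ?case by (simp add: K_Suc)
  qed
  have t_t: "t m (t m v) = t m v" "t m (t (m + k) v) = t m v" for m k v
    by (auto simp: t_def fun_eq_iff min_def)
  have trunc: "distr (K (m + k) j) ?PM (t m) = K m j" for m k j
  proof (induction k)
    \<comment> \<open>Here the claim is that \<open>K m j\<close> is invariant under
      \<open>t m\<close>: it is itself an image under \<open>t m\<close> by \<open>trunc1\<close>,
      and \<open>t m\<close> is idempotent.\<close>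
    case 0
    have "distr (K m j) ?PM (t m) = distr (distr (K (Suc m) j) ?PM (t m)) ?PM (t m)"
      by (simp add: trunc1)
    also have "\<dots> = distr (K (Suc m) j) ?PM (t m)"
      by (subst distr_distr) (auto simp: o_def t_t)
    finally show ?case by (simp add: trunc1)
  next
    case (Suc k)
    have "distr (K (m + Suc k) j) ?PM (t m) = distr (distr (K (Suc (m + k)) j) ?PM (t (m + k))) ?PM (t m)"
      by (subst distr_distr) (auto simp: o_def t_t)
    then show ?case by (simp add: trunc1 Suc)
  qed
  \<comment> \<open>\<open>insert 0\<close> provides a maximum for the empty index set. For infinite
    J the maximum is unspecified, but \<open>Q J\<close> is still a probability measure, and
    consistency is required for finite sets only.\<close>
  define Q where "Q J = distr (K (Max (insert 0 J)) 0) (PiM J (\<lambda>_. borel)) (\<lambda>v. restrict v J)" for J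
  have restr [measurable]: "(\<lambda>v. restrict v J) \<in> measurable ?PM (PiM J (\<lambda>_. borel))" for J
    by (rule measurable_restrict_subset[OF subset_UNIV])
  have Q: "Q J = distr (K n 0) (PiM J (\<lambda>_. borel)) (\<lambda>v. restrict v J)" if "J \<subseteq> {..n}" for J n
  proof -
    have fin: "finite J" using that finite_subset by blast
    let ?m = "Max (insert 0 J)"
    have "?m \<le> n" using that fin by auto
    then have "K ?m 0 = distr (K n 0) ?PM (t ?m)" using trunc[of ?m "n - ?m" 0] by simp
    moreover have "restrict (t ?m v) J = restrict v J" for v
      using fin by (auto simp: t_def fun_eq_iff restrict_def min_def)
    ultimately show ?thesis
      unfolding Q_def by (simp add: distr_distr o_def)
  qed
  interpret polish_projective UNIV Q
  proof (rule polish_projective.intro, rule projective_family.intro)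
    fix J H :: "nat set" assume JH: "J \<subseteq> H" and "finite H"
    then obtain n where n: "H \<subseteq> {..n}" unfolding finite_nat_set_iff_bounded_le by blast
    have "(\<lambda>v. restrict v J) \<in> measurable (PiM H (\<lambda>_. borel)) (PiM J (\<lambda>_. borel :: 'a measure))"
      using JH by (rule measurable_restrict_subset)
    then show "Q J = distr (Q H) (PiM J (\<lambda>_. borel)) (\<lambda>f. restrict f J)"
      using JH n by (simp add: Q[of H n] Q[of J n] distr_distr o_def Int_absorb1 subset_trans[of J H])
  next
    fix J :: "nat set"
    show "prob_space (Q J)"
      unfolding Q_def by (rule prob_space.prob_space_distr[OF prob_K]) measurable
  qed
  note [measurable_cong] = sets_lim
  have restr_lim: "distr lim (PiM J (\<lambda>_. borel)) (\<lambda>v. restrict v J) = Q J" if "finite J" for J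
  proof (rule measure_eqI)
    fix A assume "A \<in> sets (distr lim (PiM J (\<lambda>_. borel)) (\<lambda>v. restrict v J))"
    then have A: "A \<in> sets (PiM J (\<lambda>_. borel))" by simp
    then have "emeasure (distr lim (PiM J (\<lambda>_. borel)) (\<lambda>v. restrict v J)) A
        = emeasure lim (prod_emb UNIV (\<lambda>_. borel) J A)"
      by (subst emeasure_distr) (auto simp: prod_emb_def space_PiM)
    also have "\<dots> = emeasure (Q J) A" using that A by (intro emeasure_lim_emb) auto
    finally show "emeasure (distr lim (PiM J (\<lambda>_. borel)) (\<lambda>v. restrict v J)) A = emeasure (Q J) A" .
  qed (simp add: Q_def)
  \<comment> \<open>Marginals and increments are both functions of two adjacent coordinates, so the
    index set \<open>{i, Suc i}\<close> serves for both.\<close>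
  have fin_law: "distr lim borel (\<lambda>v. f (restrict v {i, Suc i})) = distr (K (Suc i) 0) borel (\<lambda>v. f (restrict v {i, Suc i}))"
    if f: "f \<in> borel_measurable (PiM {i, Suc i} (\<lambda>_. borel :: 'a measure))" for i and f :: "_ \<Rightarrow> 'a"
  proof -
    have "distr lim borel (\<lambda>v. f (restrict v {i, Suc i})) = distr (Q {i, Suc i}) borel f"
      using f by (subst restr_lim[symmetric]) (auto simp: distr_distr o_def)
    also have "\<dots> = distr (K (Suc i) 0) borel (\<lambda>v. f (restrict v {i, Suc i}))"
      using f by (subst Q[of _ "Suc i"]) (auto simp: distr_distr o_def)
    finally show ?thesis .
  qed
  show ?thesis
  proof (rule that[of lim])
    show "prob_space lim" by (rule P.prob_space_axioms)
    show "distr lim borel (\<lambda>v. v n) = R n" for n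
      using fin_law[of "\<lambda>v. v n" n] marg[of n "Suc n" 0] by simp
    show "distr lim borel (\<lambda>v. v n - v (Suc n)) = \<tau> n" for n
      using fin_law[of "\<lambda>v. v n - v (Suc n)" n] incr[of n "Suc n" 0] by simp
  qed simp
qed

section \<open>Necessity by characteristic functions\<close>

lemma sin_less_self:
  fixes y :: real
  assumes "0 < y" shows "sin y < y"
proof (cases "y \<le> 1")
  case True
  \<comment> \<open>Half-angle formula: strictness comes from cos (y/2) < 1.\<close>
  have "cos (y / 2) < cos 0"
    using assms True pi_gt3 by (intro cos_monotone_0_pi) auto
  moreover have "sin (y / 2) \<le> y / 2" using assms by (intro sin_x_le_x) simp
  moreover have "0 < sin (y / 2)" using assms True pi_gt3 by (intro sin_gt_zero) auto
  ultimately have "sin (y / 2) * cos (y / 2) < y / 2 * 1"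
    by (intro less_le_trans[OF mult_strict_left_mono]) auto
  then show ?thesis using sin_double[of "y / 2"] by simp
next
  case False
  then show ?thesis using sin_le_one[of y] by linarith
qed

text \<open>Since y - sin y is nondecreasing, the quantity is at least (a - sin a) / 2 for y between
  a and 2; beyond 2, sin y \<le> 1 gives sin y / y \<le> 1/2.\<close>

lemma sinc_gap:
  fixes a :: real
  assumes "0 < a"
  obtains \<kappa> where "0 < \<kappa>" "\<And>y. a \<le> y \<Longrightarrow> \<kappa> \<le> 1 - sin y / y"
proof -
  define k where "k = a - sin a"
  have k: "0 < k" using sin_less_self[OF assms] by (simp add: k_def)
  show ?thesis
  proof (rule that[of "min (1/2) (k/2)"])
    fix y assume y: "a \<le> y"
    show "min (1/2) (k/2) \<le> 1 - sin y / y"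
    proof (cases "y \<le> 2")
      case True
      have "a - sin a \<le> y - sin y"
        by (rule DERIV_nonneg_imp_nondecreasing[OF y])
          (auto intro!: exI derivative_eq_intros)
      moreover have "k / 2 \<le> k / y" using k y True assms by (intro divide_left_mono) auto
      moreover have "k / y \<le> (y - sin y) / y" if "k \<le> y - sin y"
        using that y assms by (intro divide_right_mono) auto
      ultimately have "k / 2 \<le> (y - sin y) / y" unfolding k_def by linarith
      also have "\<dots> = 1 - sin y / y" using y assms by (simp add: diff_divide_distrib)
      finally show ?thesis by (rule min.coboundedI2)
    next
      case False
      then have "sin y / y \<le> 1 / 2" using sin_le_one[of y] order_trans[of "sin y * 2" 2 y] by (simp add: divide_le_eq)
      then show ?thesis by (intro min.coboundedI1) simp
    qed
  qed (use k in simp)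
qed

lemma nn_integral_one_minus_cos:
  fixes x d :: real
  assumes "x \<noteq> 0" "0 \<le> d"
  shows "(\<integral>\<^sup>+s. ennreal (1 - cos (s * x)) * indicator {0..d} s \<partial>lborel) = ennreal (d - sin (d * x) / x)"
proof -
  have "(\<integral>\<^sup>+s. ennreal (1 - cos (s * x)) * indicator {0..d} s \<partial>lborel)
      = ennreal ((d - sin (d * x) / x) - (0 - sin (0 * x) / x))"
    using assms by (intro nn_integral_FTC_Icc) (auto intro!: derivative_eq_intros)
  then show ?thesis by simp
qed

text \<open>Averaging over the parameter \<open>s\<close> turns a bound on characteristic functions near \<open>0\<close>
  into a bound on tails.\<close>

lemma tails_of_characteristic_bound:
  fixes x :: "nat \<Rightarrow> 'b \<Rightarrow> real"
  assumes "prob_space M" and [measurable]: "\<And>i. x i \<in> borel_measurable M"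
    and "0 < d" "0 < \<epsilon>"
    and bound: "\<And>s n. s \<in> {0..d} \<Longrightarrow> (\<Sum>i<n. \<integral>v. 1 - cos (s * x i v) \<partial>M) \<le> C"
  shows "(\<Sum>i. emeasure M {v\<in>space M. \<epsilon> \<le> \<bar>x i v\<bar>}) < \<infinity>"
proof -
  interpret prob_space M by fact
  interpret L: pair_sigma_finite lborel M ..
  obtain \<kappa> where \<kappa>: "0 < \<kappa>" "\<And>y. d * \<epsilon> \<le> y \<Longrightarrow> \<kappa> \<le> 1 - sin y / y"
    using sinc_gap[of "d * \<epsilon>"] \<open>0 < d\<close> \<open>0 < \<epsilon>\<close> by auto
  have pos: "0 < d * \<kappa>" using \<open>0 < d\<close> \<kappa> by simp
  define g where "g s i v = ennreal (1 - cos (s * x i v)) * indicator {0..d} s" for s i v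
  have g_meas [measurable]: "(\<lambda>(s, v). g s i v) \<in> borel_measurable (lborel \<Otimes>\<^sub>M M)" for i
    unfolding g_def by measurable
  \<comment> \<open>Averaging 1 - cos (s x) over s in [0, d] gives 1 - sin (d x) / (d x). This is
    even in x and at least \<open>\<kappa>\<close> on the tail event, where d |x| \<ge> d
    \<epsilon>.\<close>
  have low: "ennreal (d * \<kappa>) * indicator {v\<in>space M. \<epsilon> \<le> \<bar>x i v\<bar>} v \<le> (\<integral>\<^sup>+s. g s i v \<partial>lborel)" for i v
  proof (cases "v \<in> space M \<and> \<epsilon> \<le> \<bar>x i v\<bar>")
    case True
    then have nz: "x i v \<noteq> 0" using \<open>0 < \<epsilon>\<close> by auto
    have "\<kappa> \<le> 1 - sin (d * \<bar>x i v\<bar>) / (d * \<bar>x i v\<bar>)"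
      using True \<open>0 < d\<close> by (intro \<kappa>) auto
    also have "\<dots> = 1 - sin (d * x i v) / (d * x i v)" by (cases "0 \<le> x i v") auto
    finally have "d * \<kappa> \<le> d * (1 - sin (d * x i v) / (d * x i v))"
      using \<open>0 < d\<close> by (intro mult_left_mono) auto
    also have "\<dots> = d - sin (d * x i v) / x i v"
      using \<open>0 < d\<close> nz by (simp add: field_simps)
    finally show ?thesis
      using nz True \<open>0 < d\<close> unfolding g_def
      by (subst nn_integral_one_minus_cos) (auto intro: ennreal_leI)
  qed auto
  have part: "(\<Sum>i<n. emeasure M {v\<in>space M. \<epsilon> \<le> \<bar>x i v\<bar>}) \<le> ennreal (d * C / (d * \<kappa>))" for n
  proof -
    have "ennreal (d * \<kappa>) * (\<Sum>i<n. emeasure M {v\<in>space M. \<epsilon> \<le> \<bar>x i v\<bar>})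
        = (\<Sum>i<n. \<integral>\<^sup>+v. ennreal (d * \<kappa>) * indicator {v\<in>space M. \<epsilon> \<le> \<bar>x i v\<bar>} v \<partial>M)"
      by (simp add: sum_distrib_left nn_integral_cmult)
    also have "\<dots> \<le> (\<Sum>i<n. \<integral>\<^sup>+v. \<integral>\<^sup>+s. g s i v \<partial>lborel \<partial>M)"
      by (intro sum_mono nn_integral_mono low)
    also have "\<dots> = (\<Sum>i<n. \<integral>\<^sup>+s. \<integral>\<^sup>+v. g s i v \<partial>M \<partial>lborel)"
      by (intro sum.cong refl L.Fubini') (simp add: g_meas)
    also have "\<dots> = (\<integral>\<^sup>+s. (\<Sum>i<n. \<integral>\<^sup>+v. g s i v \<partial>M) \<partial>lborel)"
      by (intro nn_integral_sum[symmetric]) simp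
    also have "\<dots> \<le> (\<integral>\<^sup>+s. ennreal C * indicator {0..d} s \<partial>lborel)"
    proof (rule nn_integral_mono)
      fix s :: real
      show "(\<Sum>i<n. \<integral>\<^sup>+v. g s i v \<partial>M) \<le> ennreal C * indicator {0..d} s"
      proof (cases "s \<in> {0..d}")
        case True
        have int: "integrable M (\<lambda>v. 1 - cos (s * x i v))" for i
        proof (rule integrable_const_bound[where B = 2])
          have "\<bar>1 - cos y\<bar> \<le> 2" for y :: real
            using cos_le_one[of y] cos_ge_minus_one[of y] by linarith
          then show "AE v in M. norm (1 - cos (s * x i v)) \<le> 2" by simp
        qed measurable
        have "(\<Sum>i<n. \<integral>\<^sup>+v. g s i v \<partial>M) = (\<Sum>i<n. ennreal (\<integral>v. 1 - cos (s * x i v) \<partial>M))"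
          using True by (intro sum.cong refl) (simp add: g_def nn_integral_eq_integral[OF int])
        also have "\<dots> = ennreal (\<Sum>i<n. \<integral>v. 1 - cos (s * x i v) \<partial>M)"
          by (intro sum_ennreal integral_nonneg) auto
        also have "\<dots> \<le> ennreal C" using True by (intro ennreal_leI bound)
        finally show ?thesis using True by simp
      qed (simp add: g_def)
    qed
    also have "\<dots> = ennreal (d * C)"
      using \<open>0 < d\<close> by (simp add: nn_integral_cmult ennreal_mult'' mult.commute)
    finally have "ennreal (d * \<kappa>) * (\<Sum>i<n. emeasure M {v\<in>space M. \<epsilon> \<le> \<bar>x i v\<bar>}) \<le> ennreal (d * C)" .
    then have "ennreal (d * \<kappa>) * (\<Sum>i<n. emeasure M {v\<in>space M. \<epsilon> \<le> \<bar>x i v\<bar>})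
        \<le> ennreal (d * \<kappa>) * ennreal (d * C / (d * \<kappa>))"
      using pos by (simp add: ennreal_mult'[symmetric])
    then show ?thesis
      using pos by (subst (asm) ennreal_mult_le_mult_iff) auto
  qed
  have "(\<Sum>i. emeasure M {v\<in>space M. \<epsilon> \<le> \<bar>x i v\<bar>}) \<le> ennreal (d * C / (d * \<kappa>))"
    unfolding suminf_eq_SUP by (intro SUP_least part)
  also have "\<dots> < \<infinity>" by simp
  finally show ?thesis .
qed

text \<open>For linear f this is the characteristic function, with f as a point of the dual space.
  Keeping the functional instead of a vector turns an image under \<phi> into a composition, without
  adjoints.\<close>

definition char_along :: "'a measure \<Rightarrow> ('a \<Rightarrow> real) \<Rightarrow> complex" where
  "char_along M f = (\<integral>v. cis (f v) \<partial>M)"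

lemma integrable_cis:
  assumes "finite_measure M" "f \<in> borel_measurable M"
  shows "integrable M (\<lambda>v. cis (f v))"
proof -
  interpret finite_measure M by fact
  have "(\<lambda>v. cis (f v)) \<in> borel_measurable M"
    by (rule measurable_compose[OF assms(2)])
      (auto intro!: borel_measurable_continuous_onI continuous_intros)
  then show ?thesis by (intro integrable_const_bound[where B = 1]) auto
qed

lemma norm_char_along_le_1:
  assumes "prob_space M" shows "norm (char_along M f) \<le> 1"
proof -
  interpret prob_space M by fact
  have "norm (char_along M f) \<le> (\<integral>v. norm (cis (f v)) \<partial>M)"
    unfolding char_along_def by (rule integral_norm_bound)
  then show ?thesis by (simp add: prob_space)
qed

lemma char_along_convolution:
  fixes f :: "'a::ordered_euclidean_space \<Rightarrow> real"
  assumes M: "borel_prob M" and N: "borel_prob N" and "linear f"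
  shows "char_along (M \<star> N) f = char_along M f * char_along N f"
proof -
  note [measurable_cong] = borel_probD(2)[OF M] borel_probD(2)[OF N]
  have [measurable]: "f \<in> borel_measurable borel"
    by (rule linear_borel_measurable[OF \<open>linear f\<close>])
  have [measurable]: "cis \<in> borel_measurable borel"
    by (intro borel_measurable_continuous_onI continuous_intros)
  interpret M: prob_space M by (rule borel_probD[OF M])
  interpret N: prob_space N by (rule borel_probD[OF N])
  interpret pair_sigma_finite M N ..
  interpret MN: prob_space "M \<Otimes>\<^sub>M N" by (intro prob_space_pair M.prob_space_axioms N.prob_space_axioms)
  have "char_along (M \<star> N) f = (\<integral>z. cis (f (fst z + snd z)) \<partial>(M \<Otimes>\<^sub>M N))"
    unfolding char_along_def convolution_def by (subst integral_distr) (auto simp: case_prod_unfold)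
  also have "\<dots> = (\<integral>x. \<integral>y. cis (f (x + y)) \<partial>N \<partial>M)"
    by (subst integral_fst'[symmetric]) (auto intro!: integrable_cis MN.finite_measure_axioms)
  also have "\<dots> = (\<integral>x. cis (f x) * char_along N f \<partial>M)"
    by (simp add: linear_add[OF \<open>linear f\<close>] char_along_def flip: cis_mult)
  finally show ?thesis by (simp add: char_along_def)
qed

lemma char_along_distr:
  assumes [measurable]: "\<phi> \<in> measurable M borel" "f \<in> borel_measurable borel"
  shows "char_along (distr M borel \<phi>) f = char_along M (f \<circ> \<phi>)"
proof -
  have [measurable]: "cis \<in> borel_measurable borel"
    by (intro borel_measurable_continuous_onI continuous_intros)
  show ?thesis unfolding char_along_def by (subst integral_distr) auto
qed

lemma borel_prob_discounted_sum_law: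
  assumes "linear \<phi>" "borel_prob \<sigma>"
  shows "borel_prob (discounted_sum_law \<phi> \<sigma> n)"
  using assms by (induction n) (auto intro!: borel_prob_return borel_prob_convolution
      borel_prob_distr_borel linear_borel_measurable)

text \<open>The induction varies f, since each image under \<open>\<phi>\<close> is absorbed into
  the functional as \<open>f \<circ> \<phi>\<close>.\<close>

lemma char_along_discounted_sum_law:
  fixes f :: "'a::ordered_euclidean_space \<Rightarrow> real"
  assumes "linear \<phi>" "borel_prob \<sigma>" "linear f"
  shows "char_along (discounted_sum_law \<phi> \<sigma> n) f = (\<Prod>i<n. char_along \<sigma> (f \<circ> (\<phi> ^^ i)))"
  using assms(3)
proof (induction n arbitrary: f)
  case 0
  interpret prob_space "return borel (0::'a)" by (simp add: prob_space_return)
  have [measurable]: "f \<in> borel_measurable borel"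
    by (rule linear_borel_measurable[OF 0])
  have "cis \<in> borel_measurable borel"
    by (intro borel_measurable_continuous_onI continuous_intros)
  then have "(\<lambda>v. cis (f v)) \<in> borel_measurable borel" by measurable
  then show ?case by (simp add: char_along_def integral_return linear_0[OF 0])
next
  case (Suc n)
  have m: "f \<in> borel_measurable borel"
    by (rule linear_borel_measurable[OF Suc.prems])
  note Q = borel_prob_discounted_sum_law[OF assms(1,2)]
  note phi = linear_borel_measurable[OF assms(1)]
  have "char_along (discounted_sum_law \<phi> \<sigma> (Suc n)) f
      = char_along \<sigma> f * char_along (discounted_sum_law \<phi> \<sigma> n) (f \<circ> \<phi>)"
    using char_along_distr[of \<phi> "discounted_sum_law \<phi> \<sigma> n" f] m phi
    unfolding measurable_cong_sets[OF borel_probD(2)[OF Q] refl]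
    by (simp add: char_along_convolution[OF assms(2) borel_prob_distr_borel[OF Q phi] Suc.prems])
  also have "\<dots> = char_along \<sigma> f * (\<Prod>i<n. char_along \<sigma> (f \<circ> (\<phi> ^^ Suc i)))"
    using Suc.IH[of "f \<circ> \<phi>"] linear_compose[OF assms(1) Suc.prems]
    by (simp add: comp_def funpow_swap1)
  also have "\<dots> = (\<Prod>i<Suc n. char_along \<sigma> (f \<circ> (\<phi> ^^ i)))"
    by (subst prod.lessThan_Suc_shift) simp
  finally show ?case .
qed

text \<open>The squared modulus is the characteristic function of the difference of two independent
  copies, hence an integral of a cosine; then 1 - t \<le> exp (- t).\<close>

lemma norm_char_along_sq_le:
  fixes f :: "'a::ordered_euclidean_space \<Rightarrow> real"
  assumes M: "borel_prob M" and "linear f"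
  shows "(norm (char_along M f))\<^sup>2 \<le>
    exp (- (\<integral>v. 1 - cos (f v) \<partial>distr (M \<Otimes>\<^sub>M M) borel (\<lambda>(x, y). x - y)))"
proof -
  note [measurable_cong] = borel_probD(2)[OF M]
  have [measurable]: "f \<in> borel_measurable borel"
    by (rule linear_borel_measurable[OF \<open>linear f\<close>])
  have [measurable]: "cis \<in> borel_measurable borel"
    by (intro borel_measurable_continuous_onI continuous_intros)
  interpret M: prob_space M by (rule borel_probD[OF M])
  interpret pair_sigma_finite M M ..
  interpret MM: prob_space "M \<Otimes>\<^sub>M M" by (intro prob_space_pair M.prob_space_axioms)
  have int: "integrable (M \<Otimes>\<^sub>M M) (\<lambda>z. cis (f (fst z - snd z)))"
    by (rule integrable_cis) (auto intro: MM.finite_measure_axioms)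
  have "of_real ((norm (char_along M f))\<^sup>2) = char_along M f * cnj (char_along M f)"
    by (rule complex_norm_square)
  also have "\<dots> = (\<integral>x. cis (f x) * (\<integral>y. cis (- f y) \<partial>M) \<partial>M)"
    by (simp add: char_along_def flip: integral_cnj cis_cnj)
  also have "\<dots> = (\<integral>x. \<integral>y. cis (f (x - y)) \<partial>M \<partial>M)"
    by (simp add: linear_diff[OF \<open>linear f\<close>] flip: cis_mult integral_mult_right_zero diff_conv_add_uminus)
       (simp add: cis_mult)
  also have "\<dots> = (\<integral>z. cis (f (fst z - snd z)) \<partial>(M \<Otimes>\<^sub>M M))"
    by (subst integral_fst'[symmetric, OF int]) simp
  finally have "(norm (char_along M f))\<^sup>2 = Re (\<integral>z. cis (f (fst z - snd z)) \<partial>(M \<Otimes>\<^sub>M M))"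
    by (metis Re_complex_of_real)
  also have "\<dots> = (\<integral>z. cos (f (fst z - snd z)) \<partial>(M \<Otimes>\<^sub>M M))"
    using integral_Re[OF int] by simp
  also have "\<dots> = 1 - (\<integral>z. 1 - cos (f (fst z - snd z)) \<partial>(M \<Otimes>\<^sub>M M))"
  proof -
    have "integrable (M \<Otimes>\<^sub>M M) (\<lambda>z. cos (f (fst z - snd z)))"
      by (rule MM.integrable_const_bound[where B = 1]) auto
    then show ?thesis by (simp add: MM.prob_space)
  qed
  also have "(\<integral>z. 1 - cos (f (fst z - snd z)) \<partial>(M \<Otimes>\<^sub>M M))
      = (\<integral>v. 1 - cos (f v) \<partial>distr (M \<Otimes>\<^sub>M M) borel (\<lambda>(x, y). x - y))" (is "_ = ?I")
    by (subst integral_distr) (auto simp: case_prod_unfold)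
  also have "1 - ?I \<le> exp (- ?I)" using exp_ge_add_one_self[of "- ?I"] by simp
  finally show ?thesis .
qed

section \<open>From a solution to tails of the symmetrized noise law\<close>

lemma contraction_subspace_borel:
  fixes \<phi> :: "'a::euclidean_space \<Rightarrow> 'a"
  assumes "linear \<phi>" shows "contraction_subspace \<phi> \<in> sets borel"
  using closed_subspace[OF subspace_contraction_subspace[OF assms]] by simp

text \<open>Separates the noise of n steps from the transported initial law. With time shifted, it
  applies to a bi-infinite solution started at any negative time.\<close>

lemma recursion_unfold:
  fixes \<phi> :: "'a::ordered_euclidean_space \<Rightarrow> 'a"
  assumes lin: "linear \<phi>" and \<sigma>: "borel_prob \<sigma>" and T: "borel_prob (T 0)"
    and rec: "\<And>n. T (Suc n) = (\<sigma> \<star> distr (T n) borel \<phi>)"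
  shows "T n = (discounted_sum_law \<phi> \<sigma> n \<star> distr (T 0) borel (\<phi> ^^ n))"
proof (induction n)
  case 0
  show ?case
    using borel_prob_convolution_commute[OF borel_prob_return[of 0] T] convolution_return_0[OF T]
      distr_borel_ident[OF borel_probD(2)[OF T]] by (simp add: id_def)
next
  case (Suc n)
  let ?Q = "discounted_sum_law \<phi> \<sigma> n" and ?D = "distr (T 0) borel (\<phi> ^^ n)"
  have meas: "\<phi> \<in> borel_measurable borel" "\<phi> ^^ n \<in> borel_measurable borel"
    using linear_borel_measurable[OF lin] linear_borel_measurable[OF linear_funpow[OF lin]] by auto
  have Q: "borel_prob ?Q" by (rule borel_prob_discounted_sum_law[OF lin \<sigma>])
  have D: "borel_prob ?D" using T meas by (intro borel_prob_distr_borel)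
  have "T (Suc n) = (\<sigma> \<star> (distr ?Q borel \<phi> \<star> distr ?D borel \<phi>))"
    using distr_convolution[OF Q D lin] by (simp only: rec Suc[symmetric])
  also have "\<dots> = (discounted_sum_law \<phi> \<sigma> (Suc n) \<star> distr ?D borel \<phi>)"
    using Q D \<sigma> meas by (simp add: borel_prob_convolution_assoc borel_prob_distr_borel)
  also have "distr ?D borel \<phi> = distr (T 0) borel (\<phi> ^^ Suc n)"
  proof -
    have "\<phi> ^^ n \<in> borel_measurable (T 0)"
      using meas(2) measurable_cong_sets[OF borel_probD(2)[OF T] refl] by blast
    then show ?thesis using meas(1) by (subst distr_distr) auto
  qed
  finally show ?case .
qed

lemma convolution_interchange:
  assumes "borel_prob A" "borel_prob B" "borel_prob C" "borel_prob D"
  shows "((A \<star> B) \<star> (C \<star> D)) = ((A \<star> C) \<star> (B \<star> D))"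
proof -
  have "((A \<star> B) \<star> (C \<star> D)) = (A \<star> ((B \<star> C) \<star> D))"
    using assms by (simp add: borel_prob_convolution_assoc borel_prob_convolution)
  also have "(B \<star> C) = (C \<star> B)" using assms by (intro borel_prob_convolution_commute)
  finally show ?thesis
    using assms by (simp add: borel_prob_convolution_assoc borel_prob_convolution)
qed

text \<open>As a function of s this is the characteristic function of the real law
  \<open>distr M borel g\<close>, which is continuous at 0 with value 1 there.\<close>

lemma norm_char_along_near_0:
  fixes M :: "'a::ordered_euclidean_space measure"
  assumes M: "borel_prob M" and [measurable]: "g \<in> borel_measurable borel"
  obtains d where "0 < d" "\<And>s. s \<in> {0..d} \<Longrightarrow> 1 / 2 \<le> norm (char_along M (\<lambda>v. s * g v))"
proof -
  note [measurable_cong] = borel_probD(2)[OF M]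
  define N where "N = distr M borel g"
  interpret M: prob_space M by (rule borel_probD[OF M])
  interpret N: real_distribution N
    unfolding N_def by (rule M.real_distribution_distr) measurable
  have char: "char N s = char_along M (\<lambda>v. s * g v)" for s
    unfolding char_def char_along_def N_def cis_conv_exp by (subst integral_distr) auto
  have "(char N \<longlongrightarrow> char N 0) (at 0)"
    using N.isCont_char[of 0] by (simp add: isCont_def)
  then obtain d where d: "0 < d" "\<And>s. s \<noteq> 0 \<Longrightarrow> dist s 0 < d \<Longrightarrow> dist (char N s) (char N 0) < 1 / 2"
    unfolding LIM_def by (metis half_gt_zero zero_less_one)
  show ?thesis
  proof (rule that[of "d / 2"])
    fix s assume s: "s \<in> {0..d / 2}"
    have "norm (char N s - 1) < 1 / 2"
    proof (cases "s = 0")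
      case False
      with s d(1) d(2)[of s] show ?thesis by (simp add: N.char_zero dist_norm)
    qed (simp add: N.char_zero)
    moreover have "1 - norm (char N s) \<le> norm (char N s - 1)"
      by (metis norm_minus_commute norm_one norm_triangle_ineq2)
    ultimately show "1 / 2 \<le> norm (char_along M (\<lambda>v. s * g v))" by (simp flip: char)
  qed (use d in simp)
qed

text \<open>Symmetrizing makes \<open>\<bar>char_along \<mu> f\<bar>\<^sup>2\<close> the integral of a cosine, so a lower bound on the product
  becomes an upper bound on a sum.\<close>

lemma symmetrization_tails:
  fixes \<phi> :: "'a::ordered_euclidean_space \<Rightarrow> 'a"
  assumes lin: "linear \<phi>" and \<mu>: "borel_prob \<mu>" and sol: "solution \<phi> \<mu> \<Lambda>" and "0 < \<epsilon>"
  defines "W \<equiv> distr (\<mu> \<Otimes>\<^sub>M \<mu>) borel (\<lambda>(x, y). x - y)"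
  shows "(\<Sum>i. emeasure W {v. \<epsilon> \<le> norm ((\<phi> ^^ i) v)}) < \<infinity>"
proof -
  note [measurable_cong] = borel_probD(2)[OF \<mu>]
  have W: "borel_prob W"
    unfolding W_def using borel_probD(1)[OF \<mu>] by (intro borel_prob_distr prob_space_pair) auto
  note [measurable_cong] = borel_probD(2)[OF W]
  have sp: "space W = UNIV" by (rule borel_probD[OF W])
  have pow [measurable]: "\<phi> ^^ n \<in> borel_measurable borel" for n
    by (rule linear_borel_measurable[OF linear_funpow[OF lin]])
  have \<Lambda>: "borel_prob (\<Lambda> k)" and rec: "\<Lambda> k = (\<mu> \<star> distr (\<Lambda> (k - 1)) borel \<phi>)" for k
    using sol unfolding solution_def by blast+
  \<comment> \<open>The recursion is run from time -n to time 0. The left side does not depend on n,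
    which makes the bounds below uniform in n.\<close>
  have unfold: "\<Lambda> 0 = (discounted_sum_law \<phi> \<mu> n \<star> distr (\<Lambda> (- int n)) borel (\<phi> ^^ n))" for n
  proof -
    have "\<Lambda> (int (Suc m) - int n) = (\<mu> \<star> distr (\<Lambda> (int m - int n)) borel \<phi>)" for m
      using rec[of "int (Suc m) - int n"] by (simp add: algebra_simps)
    from recursion_unfold[where T = "\<lambda>m. \<Lambda> (int m - int n)" and n = n, OF lin \<mu> \<Lambda> this]
    show ?thesis by simp
  qed
  \<comment> \<open>One coordinate at a time, because the radius d within which the characteristic
    function stays above 1/2 is obtained for a fixed direction b.\<close>
  have coord: "(\<Sum>i. emeasure W {v\<in>space W. e \<le> \<bar>(\<phi> ^^ i) v \<bullet> b\<bar>}) < \<infinity>" if "0 < e" for b e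
  proof -
    obtain d where d: "0 < d" "\<And>s. s \<in> {0..d} \<Longrightarrow> 1 / 2 \<le> norm (char_along (\<Lambda> 0) (\<lambda>v. s * (v \<bullet> b)))"
      by (rule norm_char_along_near_0[OF \<Lambda>, of "\<lambda>v. v \<bullet> b"]) auto
    show ?thesis
    proof (rule tails_of_characteristic_bound[OF borel_probD(1)[OF W] _ d(1) that, of "\<lambda>i v. (\<phi> ^^ i) v \<bullet> b" "ln 4"])
      fix s n assume s: "s \<in> {0..d}"
      define f where "f v = s * (v \<bullet> b)" for v
      have f: "linear f" unfolding f_def
        by (rule linearI) (simp_all add: inner_add_left algebra_simps)
      have fi: "linear (f \<circ> (\<phi> ^^ i))" for i
        by (rule linear_compose[OF linear_funpow[OF lin] f])
      let ?I = "\<lambda>i. \<integral>v. 1 - cos (s * ((\<phi> ^^ i) v \<bullet> b)) \<partial>W"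
      have "norm (char_along (\<Lambda> 0) f) = norm (char_along (discounted_sum_law \<phi> \<mu> n) f) *
          norm (char_along (distr (\<Lambda> (- int n)) borel (\<phi> ^^ n)) f)"
        using \<Lambda> by (subst unfold[of n], subst char_along_convolution)
          (auto intro!: borel_prob_discounted_sum_law lin \<mu> f borel_prob_distr_borel pow simp: norm_mult)
      \<comment> \<open>The unknown law at time -n contributes a factor of modulus at most 1, which
        is dropped.\<close>
      also have "\<dots> \<le> norm (char_along (discounted_sum_law \<phi> \<mu> n) f) * 1"
        using borel_prob_distr_borel[OF \<Lambda> pow] borel_probD(1)
        by (intro mult_left_mono norm_char_along_le_1) auto
      also have "\<dots> = (\<Prod>i<n. norm (char_along \<mu> (f \<circ> (\<phi> ^^ i))))"
        by (simp add: char_along_discounted_sum_law[OF lin \<mu> f] prod_norm)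
      finally have "(1 / 2)\<^sup>2 \<le> (\<Prod>i<n. norm (char_along \<mu> (f \<circ> (\<phi> ^^ i))))\<^sup>2"
        using d(2)[OF s] unfolding f_def[abs_def, symmetric] by (intro power_mono) auto
      also have "\<dots> = (\<Prod>i<n. (norm (char_along \<mu> (f \<circ> (\<phi> ^^ i))))\<^sup>2)"
        by (simp add: prod_power_distrib)
      also have "\<dots> \<le> (\<Prod>i<n. exp (- ?I i))"
        using norm_char_along_sq_le[OF \<mu> fi] by (intro prod_mono) (auto simp: W_def f_def)
      also have "\<dots> = exp (- (\<Sum>i<n. ?I i))"
        by (simp add: exp_sum sum_negf[symmetric])
      \<comment> \<open>The constant ln 4 is minus the logarithm of the squared lower bound
        1/2.\<close>
      finally have "ln ((1 / 2)\<^sup>2) \<le> ln (exp (- (\<Sum>i<n. ?I i)))"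
        by (subst ln_le_cancel_iff) auto
      then have "ln ((1 / 2)\<^sup>2) \<le> - (\<Sum>i<n. ?I i)" by (simp only: ln_exp)
      moreover have "ln ((1 / 2)\<^sup>2) = - ln (4 :: real)"
        by (simp add: power2_eq_square ln_div)
      ultimately show "(\<Sum>i<n. ?I i) \<le> ln 4" by simp
    qed measurable
  qed
  \<comment> \<open>If every coordinate is below \<epsilon> divided by the dimension, the l1 norm
    and hence the norm is below \<epsilon>.\<close>
  let ?e = "\<epsilon> / DIM('a)"
  have e: "0 < ?e" using \<open>0 < \<epsilon>\<close> by simp
  have "emeasure W {v. \<epsilon> \<le> norm ((\<phi> ^^ i) v)}
      \<le> (\<Sum>b\<in>Basis. emeasure W {v\<in>space W. ?e \<le> \<bar>(\<phi> ^^ i) v \<bullet> b\<bar>})" for i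
  proof -
    have "{v. \<epsilon> \<le> norm ((\<phi> ^^ i) v)} \<subseteq> (\<Union>b\<in>Basis. {v\<in>space W. ?e \<le> \<bar>(\<phi> ^^ i) v \<bullet> b\<bar>})"
    proof (rule subsetI, rule ccontr)
      fix v assume v: "v \<in> {v. \<epsilon> \<le> norm ((\<phi> ^^ i) v)}"
        and "v \<notin> (\<Union>b\<in>Basis. {v\<in>space W. ?e \<le> \<bar>(\<phi> ^^ i) v \<bullet> b\<bar>})"
      then have "(\<Sum>b\<in>Basis. \<bar>(\<phi> ^^ i) v \<bullet> b\<bar>) < (\<Sum>b\<in>(Basis::'a set). ?e)"
        by (intro sum_strict_mono) (auto simp: sp not_le)
      then have "norm ((\<phi> ^^ i) v) < \<epsilon>"
        using norm_le_l1[of "(\<phi> ^^ i) v"] by simp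
      with v show False by simp
    qed
    then have "emeasure W {v. \<epsilon> \<le> norm ((\<phi> ^^ i) v)}
        \<le> emeasure W (\<Union>b\<in>Basis. {v\<in>space W. ?e \<le> \<bar>(\<phi> ^^ i) v \<bullet> b\<bar>})"
      by (rule emeasure_mono) (intro sets.finite_UN finite_Basis, measurable)
    also have "\<dots> \<le> (\<Sum>b\<in>Basis. emeasure W {v\<in>space W. ?e \<le> \<bar>(\<phi> ^^ i) v \<bullet> b\<bar>})"
      by (rule emeasure_subadditive_finite) auto
    finally show ?thesis .
  qed
  then have "(\<Sum>i. emeasure W {v. \<epsilon> \<le> norm ((\<phi> ^^ i) v)})
      \<le> (\<Sum>i. \<Sum>b\<in>Basis. emeasure W {v\<in>space W. ?e \<le> \<bar>(\<phi> ^^ i) v \<bullet> b\<bar>})"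
    by (intro suminf_le) auto
  also have "\<dots> = (\<Sum>b\<in>Basis. \<Sum>i. emeasure W {v\<in>space W. ?e \<le> \<bar>(\<phi> ^^ i) v \<bullet> b\<bar>})"
    by (rule suminf_sum) simp
  also have "\<dots> < \<infinity>" using coord[OF e] by simp
  finally show ?thesis .
qed

text \<open>Borel-Cantelli for each threshold 1/(k+1), then a countable intersection.\<close>

lemma AE_contraction_of_tails:
  fixes \<phi> :: "'a::euclidean_space \<Rightarrow> 'a"
  assumes lin: "linear \<phi>" and W: "borel_prob W"
    and tails: "\<And>\<epsilon>. 0 < \<epsilon> \<Longrightarrow> (\<Sum>i. emeasure W {v. \<epsilon> \<le> norm ((\<phi> ^^ i) v)}) < \<infinity>"
  shows "AE v in W. v \<in> contraction_subspace \<phi>"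
proof -
  note [measurable_cong] = borel_probD(2)[OF W]
  have sp: "space W = UNIV" by (rule borel_probD[OF W])
  have [measurable]: "\<phi> ^^ n \<in> borel_measurable borel" for n
    by (rule linear_borel_measurable[OF linear_funpow[OF lin]])
  have "AE v in W. eventually (\<lambda>i. norm ((\<phi> ^^ i) v) < inverse (real (Suc k))) sequentially" for k
  proof -
    let ?A = "\<lambda>i. {v\<in>space W. inverse (real (Suc k)) \<le> norm ((\<phi> ^^ i) v)}"
    have fin: "(\<Sum>i. emeasure W (?A i)) < \<infinity>" using tails[of "inverse (real (Suc k))"] by (simp add: sp)
    have fin1: "emeasure W (?A i) < \<infinity>" for i
      using ennreal_suminf_lessD[OF fin, of i] by simp
    have "AE v in W. eventually (\<lambda>i. v \<in> space W - ?A i) sequentially"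
    proof (rule borel_cantelli_AE1)
      show "summable (\<lambda>i. measure W (?A i))"
        using fin fin1 unfolding measure_def
        by (intro summable_suminf_not_top) (auto simp: less_top)
    qed (use fin1 in measurable)
    then show ?thesis
      by eventually_elim (auto elim!: eventually_mono simp: sp not_le)
  qed
  then have "AE v in W. \<forall>k. eventually (\<lambda>i. norm ((\<phi> ^^ i) v) < inverse (real (Suc k))) sequentially"
    unfolding AE_all_countable by blast
  then show ?thesis
  proof eventually_elim
    case (elim v)
    have "eventually (\<lambda>i. dist ((\<phi> ^^ i) v) 0 < \<epsilon>) sequentially" if pos: "0 < \<epsilon>" for \<epsilon>
    proof -
      obtain k where "inverse (real (Suc k)) < \<epsilon>" using reals_Archimedean[OF pos] by blast
      with elim[rule_format, of k] show ?thesis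
        by (auto elim: eventually_mono)
    qed
    then show ?case by (simp add: contraction_subspace_def tendsto_iff)
  qed
qed

text \<open>Injectivity keeps orbits from shrinking faster than geometrically, so summable tails of
  the iterates control the logarithm through \<open>ln_le_suminf_indicator\<close>.\<close>

lemma log_moment_of_tails:
  fixes \<phi> :: "'a::euclidean_space \<Rightarrow> 'a"
  assumes lin: "linear \<phi>" and inj: "inj \<phi>" and W: "borel_prob W"
    and tails: "(\<Sum>i. emeasure W {v. 1 \<le> norm ((\<phi> ^^ i) v)}) < \<infinity>"
  shows "log_moment_condition W"
proof -
  note [measurable_cong] = borel_probD(2)[OF W]
  interpret prob_space W by (rule borel_probD[OF W])
  have sp: "space W = UNIV" by (rule borel_probD[OF W])
  have [measurable]: "\<phi> ^^ n \<in> borel_measurable borel" for n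
    by (rule linear_borel_measurable[OF linear_funpow[OF lin]])
  obtain c where c: "0 < c" "c < 1" "\<And>v n. c ^ n * norm v \<le> norm ((\<phi> ^^ n) v)"
    by (rule funpow_norm_ge[OF lin inj]) (rule that)
  have "(\<integral>\<^sup>+v. ennreal (ln (norm v + 1)) \<partial>W)
      \<le> (\<integral>\<^sup>+v. ennreal (ln 2) + ennreal (ln (1 / c)) * (\<Sum>i. indicator {1..} (norm ((\<phi> ^^ i) v))) \<partial>W)"
    using c by (intro nn_integral_mono ln_le_suminf_indicator) auto
  also have "\<dots> = ennreal (ln 2) + ennreal (ln (1 / c)) *
      (\<Sum>i. \<integral>\<^sup>+v. indicator {1..} (norm ((\<phi> ^^ i) v)) \<partial>W)"
    by (simp add: nn_integral_add nn_integral_cmult nn_integral_suminf emeasure_space_1)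
  also have "(\<Sum>i. \<integral>\<^sup>+v. indicator {1..} (norm ((\<phi> ^^ i) v)) \<partial>W)
      = (\<Sum>i. emeasure W {v. 1 \<le> norm ((\<phi> ^^ i) v)})"
  proof (intro suminf_cong)
    fix i
    have "{v\<in>space W. 1 \<le> norm ((\<phi> ^^ i) v)} \<in> sets W" by measurable
    then show "(\<integral>\<^sup>+v. indicator {1..} (norm ((\<phi> ^^ i) v)) \<partial>W) = emeasure W {v. 1 \<le> norm ((\<phi> ^^ i) v)}"
      by (subst nn_integral_indicator[symmetric])
        (auto intro!: nn_integral_cong simp: sp indicator_def simp del: nn_integral_indicator)
  qed
  also have "ennreal (ln 2) + ennreal (ln (1 / c)) * \<dots> < \<infinity>"
    using tails by (simp add: ennreal_mult_less_top)
  finally show ?thesis by (simp add: log_moment_condition_def)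
qed

section \<open>Translations and the removal of the symmetrization\<close>

lemma ln_norm_add_le:
  "ln (norm (x + y) + 1) \<le> ln (norm x + 1) + ln (norm y + 1)"
proof -
  have "norm (x + y) + 1 \<le> (norm x + 1) * (norm y + 1)"
    using norm_triangle_ineq[of x y] mult_nonneg_nonneg[OF norm_ge_zero[of x] norm_ge_zero[of y]]
    unfolding distrib_left distrib_right by linarith
  then have "ln (norm (x + y) + 1) \<le> ln ((norm x + 1) * (norm y + 1))"
    by (subst ln_le_cancel_iff) (auto intro!: mult_pos_pos add_nonneg_pos)
  also have "\<dots> = ln (norm x + 1) + ln (norm y + 1)"
    by (rule ln_mult_pos) (auto intro!: add_nonneg_pos)
  finally show ?thesis .
qed

lemma log_moment_translate:
  fixes M :: "'a::ordered_euclidean_space measure"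
  assumes M: "borel_prob M" and log: "log_moment_condition M"
  shows "log_moment_condition (M \<star> return borel a)"
proof -
  note [measurable_cong] = borel_probD(2)[OF M]
  interpret prob_space M by (rule borel_probD[OF M])
  have "(\<integral>\<^sup>+v. ennreal (ln (norm v + 1)) \<partial>(M \<star> return borel a))
      = (\<integral>\<^sup>+v. ennreal (ln (norm (v + a) + 1)) \<partial>M)"
    unfolding convolution_return[OF M] by (rule nn_integral_distr) measurable
  also have "\<dots> \<le> (\<integral>\<^sup>+v. ennreal (ln (norm v + 1)) + ennreal (ln (norm a + 1)) \<partial>M)"
    using ln_norm_add_le by (intro nn_integral_mono) (simp flip: ennreal_plus)
  also have "\<dots> = (\<integral>\<^sup>+v. ennreal (ln (norm v + 1)) \<partial>M) + ennreal (ln (norm a + 1))"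
    by (subst nn_integral_add) (auto simp: emeasure_space_1)
  also have "\<dots> < \<infinity>" using log by (simp add: log_moment_condition_def)
  finally show ?thesis by (simp add: log_moment_condition_def)
qed

lemma supported_on_translate_iff:
  fixes \<phi> :: "'a::ordered_euclidean_space \<Rightarrow> 'a"
  assumes lin: "linear \<phi>" and M: "borel_prob M"
  shows "supported_on M ((+) u ` contraction_subspace \<phi>) \<longleftrightarrow>
    (AE v in M \<star> return borel (- u). v \<in> contraction_subspace \<phi>)"
proof -
  note [measurable_cong] = borel_probD(2)[OF M]
  note [measurable] = contraction_subspace_borel[OF lin]
  have "v \<in> (+) u ` contraction_subspace \<phi> \<longleftrightarrow> v + - u \<in> contraction_subspace \<phi>" for v
    by (auto simp: image_iff) (metis add.commute diff_add_cancel)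
  then show ?thesis
    unfolding supported_on_def convolution_return[OF M] by (subst AE_distr_iff) auto
qed

lemma solution_imp_support_and_log_moment:
  fixes \<phi> :: "'a::ordered_euclidean_space \<Rightarrow> 'a"
  assumes lin: "linear \<phi>" and inj: "inj \<phi>" and \<mu>: "borel_prob \<mu>" and sol: "solution \<phi> \<mu> \<Lambda>"
  shows "\<exists>u. supported_on \<mu> ((+) u ` contraction_subspace \<phi>)" "log_moment_condition \<mu>"
proof -
  note [measurable_cong] = borel_probD(2)[OF \<mu>]
  note [measurable] = contraction_subspace_borel[OF lin]
  have sub: "subspace (contraction_subspace \<phi>)" using lin by (rule subspace_contraction_subspace)
  interpret prob_space \<mu> by (rule borel_probD[OF \<mu>])
  interpret pair_sigma_finite \<mu> \<mu> ..
  define W where "W = distr (\<mu> \<Otimes>\<^sub>M \<mu>) borel (\<lambda>(x, y). x - y)"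
  have W: "borel_prob W"
    unfolding W_def using prob_space_axioms by (intro borel_prob_distr prob_space_pair) auto
  note tails = symmetrization_tails[OF lin \<mu> sol, folded W_def]
  have "AE v in W. v \<in> contraction_subspace \<phi>"
    by (rule AE_contraction_of_tails[OF lin W tails])
  then have "AE z in \<mu> \<Otimes>\<^sub>M \<mu>. fst z - snd z \<in> contraction_subspace \<phi>"
    unfolding W_def by (subst (asm) AE_distr_iff) (auto simp: case_prod_unfold)
  then have supp: "AE x in \<mu>. AE y in \<mu>. x - y \<in> contraction_subspace \<phi>"
    by (drule_tac AE_pair) simp
  have "log_moment_condition W" by (rule log_moment_of_tails[OF lin inj W tails]) simp
  then have "(\<integral>\<^sup>+z. ennreal (ln (norm (fst z - snd z) + 1)) \<partial>(\<mu> \<Otimes>\<^sub>M \<mu>)) < \<infinity>"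
    unfolding log_moment_condition_def W_def by (subst (asm) nn_integral_distr) (auto simp: case_prod_unfold)
  then have "(\<integral>\<^sup>+x. \<integral>\<^sup>+y. ennreal (ln (norm (x - y) + 1)) \<partial>\<mu> \<partial>\<mu>) < \<infinity>"
    using sigma_finite_measure.nn_integral_fst[OF borel_probD(5)[OF \<mu>],
        of "\<lambda>z. ennreal (ln (norm (fst z - snd z) + 1))" \<mu>] by simp
  then have "AE x in \<mu>. (\<integral>\<^sup>+y. ennreal (ln (norm (x - y) + 1)) \<partial>\<mu>) \<noteq> \<infinity>"
    by (intro nn_integral_PInf_AE) auto
  with supp have "AE x in \<mu>. (AE y in \<mu>. x - y \<in> contraction_subspace \<phi>) \<and>
      (\<integral>\<^sup>+y. ennreal (ln (norm (x - y) + 1)) \<partial>\<mu>) \<noteq> \<infinity>"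
    by eventually_elim simp
  \<comment> \<open>Both properties hold for almost every section, and a set of full measure is
    nonempty; the support and the moment thus come from the same point u.\<close>
  then obtain u where u: "AE y in \<mu>. u - y \<in> contraction_subspace \<phi>"
      "(\<integral>\<^sup>+y. ennreal (ln (norm (u - y) + 1)) \<partial>\<mu>) \<noteq> \<infinity>"
    using eventually_happens'[OF ae_filter_bot] by blast
  have "supported_on \<mu> ((+) u ` contraction_subspace \<phi>)"
    unfolding supported_on_def using u(1)
  proof eventually_elim
    case (elim y)
    have "y = u + - (u - y)" by simp
    then show ?case using subspace_neg[OF sub elim] by blast
  qed
  then show "\<exists>u. supported_on \<mu> ((+) u ` contraction_subspace \<phi>)" by blast
  have le: "ln (norm y + 1) \<le> ln (norm (u - y) + 1) + ln (norm u + 1)" for y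
    using ln_norm_add_le[of "y - u" u] by (simp add: norm_minus_commute)
  have "(\<integral>\<^sup>+y. ennreal (ln (norm y + 1)) \<partial>\<mu>)
      \<le> (\<integral>\<^sup>+y. ennreal (ln (norm (u - y) + 1)) + ennreal (ln (norm u + 1)) \<partial>\<mu>)"
    using le by (intro nn_integral_mono) (simp flip: ennreal_plus)
  also have "\<dots> = (\<integral>\<^sup>+y. ennreal (ln (norm (u - y) + 1)) \<partial>\<mu>) + ennreal (ln (norm u + 1))"
    by (subst nn_integral_add) (auto simp: emeasure_space_1)
  also have "\<dots> < \<infinity>" using u(2) by (simp add: less_top)
  finally show "log_moment_condition \<mu>" by (simp add: log_moment_condition_def)
qed

section \<open>The fundamental solution\<close>

lemma iterate_int_rec:
  assumes "bij f" shows "iterate_int f k x = f (iterate_int f (k - 1) x)"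
proof (cases "1 \<le> k")
  case True
  then have "nat k = Suc (nat (k - 1))" by simp
  then show ?thesis using True by (simp add: iterate_int_def)
next
  case False
  then have "nat (- (k - 1)) = Suc (nat (- k))" by simp
  then have "f (iterate_int f (k - 1) x) = (inv f ^^ nat (- k)) x"
    using False assms by (simp add: iterate_int_def surj_f_inv_f bij_is_surj)
  also have "\<dots> = iterate_int f k x" using False by (auto simp: iterate_int_def)
  finally show ?thesis ..
qed

text \<open>Writes k as the difference of j + nat k and j + nat (-k), both nonnegative and growing
  with j. This covers either sign of k at once and lets a solution be started ever further in the
  past.\<close>

lemma iterate_int_funpow:
  assumes "bij f"
  shows "iterate_int f k ((f ^^ (j + nat (- k))) x) = (f ^^ (j + nat k)) x"
proof (cases "0 \<le> k")
  case True
  then show ?thesis by (simp add: iterate_int_def add.commute[of j] funpow_add)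
next
  case False
  have "(inv f ^^ p) ((f ^^ (j + p)) x) = (f ^^ j) x" for p
  proof (induction p)
    case (Suc p)
    have "(inv f ^^ Suc p) ((f ^^ (j + Suc p)) x) = (inv f ^^ p) (inv f (f ((f ^^ (j + p)) x)))"
      by (simp only: funpow_Suc_right[of p "inv f"] add_Suc_right funpow.simps(2)[of "j + p"] comp_apply)
    with Suc show ?case by (simp add: inv_f_f bij_is_inj[OF assms])
  qed simp
  with False show ?thesis by (simp add: iterate_int_def)
qed

lemma linear_iterate_int:
  fixes \<phi> :: "'a::euclidean_space \<Rightarrow> 'a"
  assumes "linear \<phi>" "bij \<phi>" shows "linear (iterate_int \<phi> k)"
proof -
  have "linear (inv \<phi>)"
  proof (rule linearI)
    fix x y and r :: real
    show "inv \<phi> (x + y) = inv \<phi> x + inv \<phi> y"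
      using assms by (intro inv_f_eq) (auto simp: bij_is_inj linear_add surj_f_inv_f bij_is_surj)
    show "inv \<phi> (r *\<^sub>R x) = r *\<^sub>R inv \<phi> x"
      using assms by (intro inv_f_eq) (auto simp: bij_is_inj linear_scale surj_f_inv_f bij_is_surj)
  qed
  then show ?thesis using assms by (simp add: iterate_int_def linear_funpow)
qed

lemma distr_return_borel:
  assumes "f \<in> borel_measurable borel"
  shows "distr (return borel a) borel f = return borel (f a)"
  using assms by (intro distr_return) auto

text \<open>All three conclusions use the same realization X_n -> Y, so they concern the same
  measure. The free starting point x in the second one will absorb the initial value of the
  orbit.\<close>

lemma centred_solution:
  fixes \<phi> :: "'a::ordered_euclidean_space \<Rightarrow> 'a"
  assumes lin: "linear \<phi>" and "bij \<phi>" and \<sigma>: "borel_prob \<sigma>" and log: "log_moment_condition \<sigma>"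
    and supp: "AE v in \<sigma>. v \<in> contraction_subspace \<phi>"
  obtains \<nu> where "strongly_decomposable \<phi> \<nu> \<sigma>"
    "\<And>T x. x \<in> contraction_subspace \<phi> \<Longrightarrow> T 0 = return borel x \<Longrightarrow>
      (\<And>n. T (Suc n) = (\<sigma> \<star> distr (T n) borel \<phi>)) \<Longrightarrow> weakly_converges T \<nu>"
    "\<And>M. (\<And>k. borel_prob (M k)) \<Longrightarrow> (\<And>k. M k = (\<sigma> \<star> distr (M (k - 1)) borel \<phi>)) \<Longrightarrow>
      \<exists>\<rho>. borel_prob \<rho> \<and> (\<forall>k::int. M k = (\<nu> \<star> distr \<rho> borel (iterate_int \<phi> k)))"
proof -
  have meas [measurable]: "\<phi> \<in> borel_measurable borel" by (rule linear_borel_measurable[OF lin])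
  have pow [measurable]: "\<phi> ^^ n \<in> borel_measurable borel" for n
    by (rule linear_borel_measurable[OF linear_funpow[OF lin]])
  have iter [measurable]: "iterate_int \<phi> k \<in> borel_measurable borel" for k
    by (rule linear_borel_measurable[OF linear_iterate_int[OF lin \<open>bij \<phi>\<close>]])
  obtain S :: "(nat \<Rightarrow> 'a) measure" and X Y where S: "prob_space S" and
    X [measurable]: "\<And>n. X n \<in> borel_measurable S" and Y [measurable]: "Y \<in> borel_measurable S" and
    law: "\<And>n. distr S borel (X n) = discounted_sum_law \<phi> \<sigma> n" and
    XY: "AE \<omega> in S. (\<lambda>n. X n \<omega>) \<longlonglongrightarrow> Y \<omega>" and
    inv: "distr S borel Y = (\<sigma> \<star> distr (distr S borel Y) borel \<phi>)" and
    YC: "AE \<omega> in S. Y \<omega> \<in> contraction_subspace \<phi>"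
    using discounted_sum_converges[OF lin \<sigma> log supp] by blast
  define \<nu> where "\<nu> = distr S borel Y"
  have \<nu>: "borel_prob \<nu>" unfolding \<nu>_def using S Y by (rule borel_prob_distr)
  show ?thesis
  proof (rule that[of \<nu>])
    \<comment> \<open>Y lies in \<open>contraction_subspace \<phi>\<close> almost surely, so its
      iterates tend to 0 pointwise.\<close>
    have "weakly_converges (\<lambda>n. distr S borel (\<lambda>\<omega>. (\<phi> ^^ n) (Y \<omega>))) (distr S borel (\<lambda>_. 0))"
      using YC by (intro weakly_converges_distr S) (auto simp: contraction_subspace_def)
    then have "weakly_converges (\<lambda>n. distr \<nu> borel (\<phi> ^^ n)) (return borel 0)"
      unfolding \<nu>_def by (simp add: distr_distr comp_def prob_space.distr_const[OF S])
    then show "strongly_decomposable \<phi> \<nu> \<sigma>"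
      using \<nu> \<sigma> inv by (simp add: strongly_decomposable_def \<nu>_def[symmetric])
  next
    fix T x assume x: "x \<in> contraction_subspace \<phi>" and T0: "T 0 = return borel x"
      and rec: "\<And>n. T (Suc n) = (\<sigma> \<star> distr (T n) borel \<phi>)"
    have T: "T n = distr S borel (\<lambda>\<omega>. X n \<omega> + (\<phi> ^^ n) x)" for n
    proof -
      have "T n = (discounted_sum_law \<phi> \<sigma> n \<star> distr (T 0) borel (\<phi> ^^ n))"
        using rec by (intro recursion_unfold lin \<sigma>) (simp_all add: T0 borel_prob_return)
      also have "\<dots> = (distr S borel (X n) \<star> return borel ((\<phi> ^^ n) x))"
        by (simp only: T0 law distr_return_borel[OF pow])
      also have "\<dots> = distr S borel (\<lambda>\<omega>. X n \<omega> + (\<phi> ^^ n) x)"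
        by (subst convolution_return[OF borel_prob_distr[OF S X]]) (simp add: distr_distr comp_def)
      finally show ?thesis .
    qed
    have "AE \<omega> in S. (\<lambda>n. X n \<omega> + (\<phi> ^^ n) x) \<longlonglongrightarrow> Y \<omega>"
      using XY
    proof eventually_elim
      case (elim \<omega>)
      from tendsto_add[OF elim] x show ?case
        unfolding contraction_subspace_def by fastforce
    qed
    then have "weakly_converges (\<lambda>n. distr S borel (\<lambda>\<omega>. X n \<omega> + (\<phi> ^^ n) x)) (distr S borel Y)"
      by (intro weakly_converges_distr S) auto
    then show "weakly_converges T \<nu>" by (simp add: \<nu>_def flip: T)
  next
    fix M :: "int \<Rightarrow> 'a measure"
    assume M: "\<And>k. borel_prob (M k)" and rec: "\<And>k. M k = (\<sigma> \<star> distr (M (k - 1)) borel \<phi>)"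
    \<comment> \<open>The law at time -n transported to time 0: in this frame one step of the
      equation just splits off the factor \<open>\<tau> n\<close>.\<close>
    define R where "R n = distr (M (- int n)) borel (\<phi> ^^ n)" for n
    define \<tau> where "\<tau> n = distr \<sigma> borel (\<phi> ^^ n)" for n
    have R: "borel_prob (R n)" and \<tau>: "borel_prob (\<tau> n)" for n
      unfolding R_def \<tau>_def using M \<sigma> pow by (auto intro: borel_prob_distr_borel)
    have measM: "f \<in> borel_measurable (M k)" if "f \<in> borel_measurable borel" for k and f :: "'a \<Rightarrow> 'a"
      using that measurable_cong_sets[OF borel_probD(2)[OF M] refl] by blast
    have R_step: "R n = (\<tau> n \<star> R (Suc n))" for n
    proof -
      have "R n = (\<tau> n \<star> distr (distr (M (- int n - 1)) borel \<phi>) borel (\<phi> ^^ n))"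
        unfolding R_def \<tau>_def by (subst rec)
          (intro distr_convolution linear_funpow lin \<sigma> borel_prob_distr_borel M meas)
      also have "distr (distr (M (- int n - 1)) borel \<phi>) borel (\<phi> ^^ n) = R (Suc n)"
      proof -
        have "- int n - 1 = - int (Suc n)" by simp
        then show ?thesis
          unfolding R_def using measM[OF meas] pow
          by (simp only:) (subst distr_distr, auto simp: funpow_Suc_right simp del: funpow.simps)
      qed
      finally show ?thesis .
    qed
    obtain S' :: "(nat \<Rightarrow> 'a) measure" where S': "prob_space S'"
      and sets_S' [measurable_cong]: "sets S' = sets (PiM UNIV (\<lambda>_. borel))"
      and lawR: "\<And>n. distr S' borel (\<lambda>v. v n) = R n"
      and law\<tau>: "\<And>n. distr S' borel (\<lambda>v. v n - v (Suc n)) = \<tau> n"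
      by (rule backward_coupling[of R \<tau>, OF R \<tau> R_step]) (rule that)
    have coord [measurable]: "(\<lambda>v. v n) \<in> borel_measurable S'" for n by measurable
    obtain e where e: "summable e" and tails: "(\<Sum>n. emeasure \<sigma> {v. e n < norm ((\<phi> ^^ n) v)}) < \<infinity>"
      by (rule summable_iterate_tails[OF lin \<sigma> log supp])
    \<comment> \<open>The n-th increment has the law of \<phi>^n under \<open>\<sigma>\<close>, so
      the tail bound for the series carries over to the chain.\<close>
    have tail_eq: "emeasure S' {v\<in>space S'. e n < norm (v n - v (Suc n))}
        = emeasure \<sigma> {v. e n < norm ((\<phi> ^^ n) v)}" for n
    proof -
      have [measurable]: "\<phi> ^^ n \<in> borel_measurable \<sigma>"
        using pow measurable_cong_sets[OF borel_probD(2)[OF \<sigma>] refl] by blast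
      have B: "{x::'a. e n < norm x} \<in> sets borel" by (intro borel_open open_Collect_less continuous_intros)
      have "emeasure S' {v\<in>space S'. e n < norm (v n - v (Suc n))} = emeasure (\<tau> n) {x. e n < norm x}"
        unfolding law\<tau>[symmetric] using B
        by (subst emeasure_distr) (auto intro!: arg_cong[where f = "emeasure S'"])
      also have "\<dots> = emeasure \<sigma> {v. e n < norm ((\<phi> ^^ n) v)}"
        unfolding \<tau>_def using B borel_probD(3)[OF \<sigma>]
        by (subst emeasure_distr) (auto intro!: arg_cong[where f = "emeasure \<sigma>"])
      finally show ?thesis .
    qed
    have "AE v in S'. summable (\<lambda>n. v n - v (Suc n))"
    proof (rule AE_summable_of_tails[OF _ _ e])
      show "(\<Sum>n. emeasure S' {v\<in>space S'. e n < norm (v n - v (Suc n))}) < \<infinity>"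
        using tails by (simp only: tail_eq)
    qed measurable
    then have conv: "AE v in S'. (\<lambda>n. v n) \<longlonglongrightarrow> Lim sequentially (\<lambda>n. v n)"
    proof eventually_elim
      case (elim v)
      then have "(\<lambda>n. v 0 - (\<Sum>i<n. v i - v (Suc i))) \<longlonglongrightarrow> v 0 - (\<Sum>i. v i - v (Suc i))"
        by (intro tendsto_diff tendsto_const summable_LIMSEQ)
      then have "(\<lambda>n. v n) \<longlonglongrightarrow> v 0 - (\<Sum>i. v i - v (Suc i))"
        by (simp add: sum_lessThan_telescope')
      then show ?case using limI by metis
    qed
    define V where "V v = Lim sequentially (\<lambda>n. v n)" for v :: "nat \<Rightarrow> 'a"
    have V [measurable]: "V \<in> borel_measurable S'" unfolding V_def by measurable
    define \<rho> where "\<rho> = distr S' borel V"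
    have \<rho>: "borel_prob \<rho>" unfolding \<rho>_def using S' V by (rule borel_prob_distr)
    have "M k = (\<nu> \<star> distr \<rho> borel (iterate_int \<phi> k))" for k
    proof -
      let ?\<psi> = "iterate_int \<phi> k"
      have measV: "(\<lambda>v. ?\<psi> (Z v)) \<in> borel_measurable S'" if "Z \<in> borel_measurable S'" for Z
        by (rule measurable_compose[OF that iter])
      have meas_pair: "(\<lambda>(\<omega>, v). A \<omega> + ?\<psi> (Z v)) \<in> borel_measurable (S \<Otimes>\<^sub>M S')"
        if [measurable]: "A \<in> borel_measurable S" "Z \<in> borel_measurable S'" for A Z
        by measurable
      \<comment> \<open>Start at time -(j + nat (-k)) and run j + nat k steps to reach time k; the
        noise of these steps and the starting law live on separate factors of the product
        space.\<close>
      have Mk: "M k = distr (S \<Otimes>\<^sub>M S') borel (\<lambda>(\<omega>, v). X (j + nat k) \<omega> + ?\<psi> (v (j + nat (- k))))" for j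
      proof -
        let ?m = "j + nat k" and ?n = "j + nat (- k)"
        have "M (int (Suc i) - int ?n) = (\<sigma> \<star> distr (M (int i - int ?n)) borel \<phi>)" for i
          using rec[of "int (Suc i) - int ?n"] by (simp add: algebra_simps)
        from recursion_unfold[where T = "\<lambda>i. M (int i - int ?n)" and n = ?m, OF lin \<sigma> M this]
        have "M (int ?m - int ?n) = (discounted_sum_law \<phi> \<sigma> ?m \<star> distr (M (- int ?n)) borel (\<phi> ^^ ?m))"
          by simp
        moreover have "int ?m - int ?n = k" by simp
        moreover have "distr (M (- int ?n)) borel (\<phi> ^^ ?m) = distr (R ?n) borel ?\<psi>"
          unfolding R_def using measM[OF pow] iter
          by (subst distr_distr) (auto simp: comp_def iterate_int_funpow[OF \<open>bij \<phi>\<close>])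
        moreover have "distr (R ?n) borel ?\<psi> = distr S' borel (\<lambda>v. ?\<psi> (v ?n))"
          unfolding lawR[symmetric] by (subst distr_distr) (auto simp: comp_def)
        ultimately have "M k = (distr S borel (X ?m) \<star> distr S' borel (\<lambda>v. ?\<psi> (v ?n)))"
          by (simp only: law)
        then show ?thesis
          using convolution_distr_distr[OF S S' X measV[OF coord]] by simp
      qed
      have "AE z in S \<Otimes>\<^sub>M S'. (\<lambda>j. case z of (\<omega>, v) \<Rightarrow> X (j + nat k) \<omega> + ?\<psi> (v (j + nat (- k))))
          \<longlonglongrightarrow> (case z of (\<omega>, v) \<Rightarrow> Y \<omega> + ?\<psi> (V v))"
        using AE_pair_fst[OF S S' XY] AE_pair_snd[OF S S' conv]
      proof eventually_elim
        case (elim z)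
        have "bounded_linear ?\<psi>"
          using linear_iterate_int[OF lin \<open>bij \<phi>\<close>] by (simp add: linear_conv_bounded_linear)
        from tendsto_add[OF LIMSEQ_ignore_initial_segment[OF elim(1)]
            bounded_linear.tendsto[OF this LIMSEQ_ignore_initial_segment[OF elim(2)]]]
        show ?case by (simp add: case_prod_unfold V_def)
      qed
      then have "weakly_converges (\<lambda>j. distr (S \<Otimes>\<^sub>M S') borel (\<lambda>(\<omega>, v). X (j + nat k) \<omega> + ?\<psi> (v (j + nat (- k)))))
          (distr (S \<Otimes>\<^sub>M S') borel (\<lambda>(\<omega>, v). Y \<omega> + ?\<psi> (V v)))"
        by (intro weakly_converges_distr prob_space_pair S S' meas_pair X Y V coord)
      \<comment> \<open>\<open>M k\<close> does not depend on j, so as a constant sequence it must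
        equal the limit.\<close>
      then have "weakly_converges (\<lambda>_. M k) (distr (S \<Otimes>\<^sub>M S') borel (\<lambda>(\<omega>, v). Y \<omega> + ?\<psi> (V v)))"
        by (simp only: Mk[symmetric])
      then have "M k = distr (S \<Otimes>\<^sub>M S') borel (\<lambda>(\<omega>, v). Y \<omega> + ?\<psi> (V v))"
        by (rule weakly_converges_unique[OF weakly_converges_const _ M
              borel_prob_distr[OF prob_space_pair[OF S S'] meas_pair[OF Y V]]])
      also have "\<dots> = (\<nu> \<star> distr S' borel (\<lambda>v. ?\<psi> (V v)))"
        unfolding \<nu>_def by (rule convolution_distr_distr[symmetric, OF S S' Y measV[OF V]])
      also have "distr S' borel (\<lambda>v. ?\<psi> (V v)) = distr \<rho> borel ?\<psi>"
        unfolding \<rho>_def by (subst distr_distr) (auto simp: comp_def)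
      finally show ?thesis .
    qed
    with \<rho> show "\<exists>\<rho>. borel_prob \<rho> \<and> (\<forall>k. M k = (\<nu> \<star> distr \<rho> borel (iterate_int \<phi> k)))" by blast
  qed
qed

text \<open>The product appends the factor with the highest power of \<open>\<phi>\<close>, whereas
  (E) puts an untransformed \<open>\<mu>\<close> in front; the two agree since \<open>\<phi>\<close>
  distributes over convolution. The truncated subtraction i - 1 is exact because the product starts
  at index 1.\<close>

lemma convolution_prod_iterates_Suc:
  fixes \<phi> :: "'a::ordered_euclidean_space \<Rightarrow> 'a"
  assumes lin: "linear \<phi>" and \<mu>: "borel_prob \<mu>"
  defines "P \<equiv> convolution_prod (\<lambda>i. distr \<mu> borel (\<phi> ^^ (i - 1)))"
  shows "borel_prob (P k)" "P (Suc k) = (\<mu> \<star> distr (P k) borel \<phi>)"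
proof -
  have meas: "\<phi> \<in> borel_measurable borel" by (rule linear_borel_measurable[OF lin])
  have pow: "\<phi> ^^ n \<in> borel_measurable borel" for n
    by (rule linear_borel_measurable[OF linear_funpow[OF lin]])
  have \<mu>pow: "borel_prob (distr \<mu> borel (\<phi> ^^ n))" for n
    using \<mu> pow by (rule borel_prob_distr_borel)
  have P_Suc: "P (Suc k) = (P k \<star> distr \<mu> borel (\<phi> ^^ k))" for k by (simp add: P_def)
  have P_0: "P 0 = return borel 0" by (simp add: P_def)
  show P: "borel_prob (P k)" for k
    using \<mu>pow by (induction k) (auto simp: P_Suc P_0
        intro!: borel_prob_convolution borel_prob_return)
  show "P (Suc k) = (\<mu> \<star> distr (P k) borel \<phi>)"
  proof (induction k)
    case 0
    show ?case
      using borel_prob_convolution_commute[OF borel_prob_return \<mu>, of 0]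
      by (simp add: P_Suc P_0 distr_return_borel[OF meas] linear_0[OF lin] id_def
          distr_borel_ident[OF borel_probD(2)[OF \<mu>]])
  next
    case (Suc k)
    have "distr \<mu> borel (\<phi> ^^ Suc k) = distr (distr \<mu> borel (\<phi> ^^ k)) borel \<phi>"
    proof -
      have "\<phi> ^^ k \<in> borel_measurable \<mu>"
        using pow measurable_cong_sets[OF borel_probD(2)[OF \<mu>] refl] by blast
      then show ?thesis using meas by (subst distr_distr) auto
    qed
    then have "P (Suc (Suc k)) = ((\<mu> \<star> distr (P k) borel \<phi>) \<star> distr (distr \<mu> borel (\<phi> ^^ k)) borel \<phi>)"
      using P_Suc[of "Suc k"] by (simp only: Suc)
    also have "\<dots> = (\<mu> \<star> (distr (P k) borel \<phi> \<star> distr (distr \<mu> borel (\<phi> ^^ k)) borel \<phi>))"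
      by (intro borel_prob_convolution_assoc \<mu> borel_prob_distr_borel P meas pow)
    also have "distr (P k) borel \<phi> \<star> distr (distr \<mu> borel (\<phi> ^^ k)) borel \<phi> = distr (P (Suc k)) borel \<phi>"
      unfolding P_Suc by (rule distr_convolution[symmetric, OF P \<mu>pow lin])
    finally show ?case .
  qed
qed

text \<open>Translations can be moved from the state to the noise, because factors of a convolution
  commute. With a = -u and b = -w(k-1) this removes the centre of the noise; with the opposite signs
  it restores it.\<close>

lemma translated_step:
  fixes \<phi> :: "'a::ordered_euclidean_space \<Rightarrow> 'a"
  assumes lin: "linear \<phi>" and \<mu>: "borel_prob \<mu>" and N: "borel_prob N"
  shows "((\<mu> \<star> distr N borel \<phi>) \<star> return borel (a + \<phi> b))
    = ((\<mu> \<star> return borel a) \<star> distr (N \<star> return borel b) borel \<phi>)"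
proof -
  have meas: "\<phi> \<in> borel_measurable borel" by (rule linear_borel_measurable[OF lin])
  have "return borel (a + \<phi> b) = (return borel a \<star> return borel (\<phi> b))"
    by (rule convolution_return_return[symmetric])
  then show ?thesis
    unfolding distr_convolution[OF N borel_prob_return lin] distr_return_borel[OF meas]
    by (simp only:) (intro convolution_interchange \<mu> borel_prob_distr_borel N meas borel_prob_return)
qed

lemma convolution_return_cancel:
  fixes M :: "'a::ordered_euclidean_space measure"
  assumes "borel_prob M"
  shows "((M \<star> return borel a) \<star> return borel (- a)) = M"
  using assms by (simp add: borel_prob_convolution_assoc borel_prob_return
      convolution_return_return convolution_return_0)

text \<open>The conclusions of \<open>centred_solution\<close> carried back along the orbit w. The
  measure is obtained before w is fixed, so one \<nu> serves all orbits.\<close>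

lemma fundamental_solution_exists:
  fixes \<phi> :: "'a::ordered_euclidean_space \<Rightarrow> 'a"
  assumes lin: "linear \<phi>" and "bij \<phi>" and \<mu>: "borel_prob \<mu>"
    and supp: "supported_on \<mu> ((+) u ` contraction_subspace \<phi>)" and log: "log_moment_condition \<mu>"
  obtains \<nu> where "strongly_decomposable \<phi> \<nu> (\<mu> \<star> return borel (- u))"
    "\<And>w :: int \<Rightarrow> 'a. (\<And>k. w k = u + \<phi> (w (k - 1))) \<Longrightarrow>
      fundamental_solution \<phi> \<mu> (\<lambda>k. \<nu> \<star> return borel (w k))"
    "\<And>w :: int \<Rightarrow> 'a. (\<And>k. w k = u + \<phi> (w (k - 1))) \<Longrightarrow> w 0 \<in> contraction_subspace \<phi> \<Longrightarrow>
      weakly_converges (\<lambda>k. convolution_prod (\<lambda>i. distr \<mu> borel (\<phi> ^^ (i - 1))) k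
        \<star> return borel (- w (int k))) \<nu>"
proof -
  define \<sigma> where "\<sigma> = (\<mu> \<star> return borel (- u))"
  have \<sigma>: "borel_prob \<sigma>" unfolding \<sigma>_def by (intro borel_prob_convolution \<mu> borel_prob_return)
  have log\<sigma>: "log_moment_condition \<sigma>" unfolding \<sigma>_def using \<mu> log by (rule log_moment_translate)
  have supp\<sigma>: "AE v in \<sigma>. v \<in> contraction_subspace \<phi>"
    using supp unfolding \<sigma>_def supported_on_translate_iff[OF lin \<mu>] .
  have \<mu>_eq: "\<mu> = (\<sigma> \<star> return borel u)"
    using convolution_return_cancel[OF \<mu>, of "- u"] by (simp add: \<sigma>_def)
  show ?thesis
  proof (rule centred_solution[OF lin \<open>bij \<phi>\<close> \<sigma> log\<sigma> supp\<sigma>])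
    fix \<nu> assume dec: "strongly_decomposable \<phi> \<nu> \<sigma>"
      and conv: "\<And>T x. x \<in> contraction_subspace \<phi> \<Longrightarrow> T 0 = return borel x \<Longrightarrow>
        (\<And>n. T (Suc n) = (\<sigma> \<star> distr (T n) borel \<phi>)) \<Longrightarrow> weakly_converges T \<nu>"
      and fund: "\<And>M. (\<And>k. borel_prob (M k)) \<Longrightarrow> (\<And>k. M k = (\<sigma> \<star> distr (M (k - 1)) borel \<phi>)) \<Longrightarrow>
        \<exists>\<rho>. borel_prob \<rho> \<and> (\<forall>k::int. M k = (\<nu> \<star> distr \<rho> borel (iterate_int \<phi> k)))"
    have \<nu>: "borel_prob \<nu>" and \<nu>_eq: "\<nu> = (\<sigma> \<star> distr \<nu> borel \<phi>)"
      using dec unfolding strongly_decomposable_def by blast+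
    show ?thesis
    proof (rule that[of \<nu>])
      show "strongly_decomposable \<phi> \<nu> (\<mu> \<star> return borel (- u))" using dec unfolding \<sigma>_def .
    next
      fix w :: "int \<Rightarrow> 'a" assume w: "\<And>k. w k = u + \<phi> (w (k - 1))"
      show "fundamental_solution \<phi> \<mu> (\<lambda>k. \<nu> \<star> return borel (w k))"
        unfolding fundamental_solution_def solution_def
      proof (intro conjI allI impI)
        show "borel_prob (\<nu> \<star> return borel (w k))" for k
          by (intro borel_prob_convolution \<nu> borel_prob_return)
        fix k
        have "(\<nu> \<star> return borel (w k)) = ((\<sigma> \<star> distr \<nu> borel \<phi>) \<star> return borel (u + \<phi> (w (k - 1))))"
          by (simp only: w[of k] \<nu>_eq[symmetric])
        also have "\<dots> = (\<mu> \<star> distr (\<nu> \<star> return borel (w (k - 1))) borel \<phi>)"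
          by (simp only: translated_step[OF lin \<sigma> \<nu>] \<mu>_eq[symmetric])
        finally show "(\<nu> \<star> return borel (w k)) = (\<mu> \<star> distr (\<nu> \<star> return borel (w (k - 1))) borel \<phi>)" .
      next
        fix N :: "int \<Rightarrow> 'a measure"
        assume "(\<forall>k. borel_prob (N k)) \<and> (\<forall>k. N k = (\<mu> \<star> distr (N (k - 1)) borel \<phi>))"
        then have N: "borel_prob (N k)" and rec: "N k = (\<mu> \<star> distr (N (k - 1)) borel \<phi>)" for k
          by blast+
        \<comment> \<open>Subtracting the orbit turns any solution for \<open>\<mu>\<close> into one
          for the centred noise.\<close>
        define M where "M k = (N k \<star> return borel (- w k))" for k :: int
        have M: "borel_prob (M k)" for k
          unfolding M_def by (intro borel_prob_convolution N borel_prob_return)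
        have "M k = (\<sigma> \<star> distr (M (k - 1)) borel \<phi>)" for k
        proof -
          have "- w k = - u + \<phi> (- w (k - 1))" by (simp add: w[of k] linear_neg[OF lin])
          then have "M k = ((\<mu> \<star> distr (N (k - 1)) borel \<phi>) \<star> return borel (- u + \<phi> (- w (k - 1))))"
            unfolding M_def by (simp only: rec[of k, symmetric])
          then show ?thesis by (simp only: translated_step[OF lin \<mu> N] \<sigma>_def M_def)
        qed
        with fund[of M] M obtain \<rho> where \<rho>: "borel_prob \<rho>"
          and M_eq: "\<And>k. M k = (\<nu> \<star> distr \<rho> borel (iterate_int \<phi> k))" by blast
        have "N k = ((\<nu> \<star> return borel (w k)) \<star> distr \<rho> borel (iterate_int \<phi> k))" for k
        proof -
          have it: "borel_prob (distr \<rho> borel (iterate_int \<phi> k))"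
            by (intro borel_prob_distr_borel \<rho> linear_borel_measurable linear_iterate_int lin \<open>bij \<phi>\<close>)
          have "N k = (M k \<star> return borel (w k))"
            using convolution_return_cancel[OF N, of k "- w k"] by (simp add: M_def)
          also have "\<dots> = (return borel (w k) \<star> (\<nu> \<star> distr \<rho> borel (iterate_int \<phi> k)))"
            unfolding M_eq by (intro borel_prob_convolution_commute borel_prob_convolution \<nu> it borel_prob_return)
          also have "\<dots> = ((return borel (w k) \<star> \<nu>) \<star> distr \<rho> borel (iterate_int \<phi> k))"
            by (intro borel_prob_convolution_assoc[symmetric] \<nu> it borel_prob_return)
          also have "(return borel (w k) \<star> \<nu>) = (\<nu> \<star> return borel (w k))"
            by (intro borel_prob_convolution_commute \<nu> borel_prob_return)
          finally show ?thesis .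
        qed
        with \<rho> show "\<exists>\<rho>. borel_prob \<rho> \<and>
            (\<forall>k. N k = ((\<nu> \<star> return borel (w k)) \<star> distr \<rho> borel (iterate_int \<phi> k)))" by blast
      qed
    next
      fix w :: "int \<Rightarrow> 'a" assume w: "\<And>k. w k = u + \<phi> (w (k - 1))" and w0: "w 0 \<in> contraction_subspace \<phi>"
      let ?P = "convolution_prod (\<lambda>i. distr \<mu> borel (\<phi> ^^ (i - 1)))"
      show "weakly_converges (\<lambda>k. ?P k \<star> return borel (- w (int k))) \<nu>"
      \<comment> \<open>The recentred products obey the centred recursion but start at
        \<open>- w 0\<close> instead of 0; this is where
        \<open>w 0 \<in> contraction_subspace \<phi>\<close> enters.\<close>
      proof (rule conv[of "- w 0"])
        show "- w 0 \<in> contraction_subspace \<phi>"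
          using w0 by (rule subspace_neg[OF subspace_contraction_subspace[OF lin]])
        show "(?P 0 \<star> return borel (- w (int 0))) = return borel (- w 0)"
          by (simp add: convolution_return_return)
        fix n
        have "- w (int (Suc n)) = - u + \<phi> (- w (int n))"
          using w[of "int (Suc n)"] by (simp add: linear_neg[OF lin])
        then show "(?P (Suc n) \<star> return borel (- w (int (Suc n))))
            = (\<sigma> \<star> distr (?P n \<star> return borel (- w (int n))) borel \<phi>)"
          unfolding convolution_prod_iterates_Suc(2)[OF lin \<mu>] \<sigma>_def
          by (simp only: translated_step[OF lin \<mu> convolution_prod_iterates_Suc(1)[OF lin \<mu>]])
      qed
    qed
  qed
qed

text \<open>The orbit consists of the integer iterates of the bijection x -> u + \<phi> x, started
  at 0.\<close>

lemma affine_orbit_exists: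
  fixes \<phi> :: "'a::real_normed_vector \<Rightarrow> 'a"
  assumes "bij \<phi>"
  shows "\<exists>w :: int \<Rightarrow> 'a. w 0 = 0 \<and> (\<forall>k. w k = u + \<phi> (w (k - 1)))"
proof -
  let ?F = "\<lambda>x. u + \<phi> x"
  have "bij ?F"
    using bij_comp[OF assms bij_plus[of u]] by (simp add: comp_def)
  then have "iterate_int ?F k 0 = u + \<phi> (iterate_int ?F (k - 1) 0)" for k
    by (rule iterate_int_rec)
  moreover have "iterate_int ?F 0 0 = 0" by (simp add: iterate_int_def)
  ultimately show ?thesis by (intro exI[of _ "\<lambda>k. iterate_int ?F k 0"] conjI allI)
qed

text \<open>The k-th recentred product is the law of X_k shifted by -\<phi>^k(w 0). The limit is
  therefore stated for orbits with w 0 in \<open>contraction_subspace \<phi>\<close>, where this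
  shift dies out; the orbit with w 0 = 0, whose existence is part of the claim, is one of them.
  Quantifying \<nu> before w says that one measure serves all orbits of a given u.\<close>

theorem theorem4p1:
  fixes P :: "'w measure"
    and \<xi> :: "int \<Rightarrow> 'w \<Rightarrow> real ^ 'n"
    and \<mu> :: "(real ^ 'n) measure"
    and \<phi> :: "real ^ 'n \<Rightarrow> real ^ 'n"
  assumes "noise_with_law P \<xi> \<mu>"
    and "linear \<phi>" and "bij \<phi>"
  shows
    "((\<exists>\<Lambda>. solution \<phi> \<mu> \<Lambda>) \<longleftrightarrow>
        (\<exists>u. supported_on \<mu> ((+) u ` contraction_subspace \<phi>)) \<and> log_moment_condition \<mu>) \<and>
     ((\<exists>\<Lambda>. fundamental_solution \<phi> \<mu> \<Lambda>) \<longleftrightarrow>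
        (\<exists>u. supported_on \<mu> ((+) u ` contraction_subspace \<phi>)) \<and> log_moment_condition \<mu>) \<and>
     (\<forall>u. supported_on \<mu> ((+) u ` contraction_subspace \<phi>) \<and> log_moment_condition \<mu> \<longrightarrow>
        (\<exists>w :: int \<Rightarrow> real ^ 'n. w 0 = 0 \<and> (\<forall>k. w k = u + \<phi> (w (k - 1)))) \<and>
        (\<exists>\<nu>. strongly_decomposable \<phi> \<nu> (\<mu> \<star> return borel (- u)) \<and>
             \<nu> = ((\<mu> \<star> return borel (- u)) \<star> distr \<nu> borel \<phi>) \<and>
             (\<forall>w :: int \<Rightarrow> real ^ 'n. (\<forall>k. w k = u + \<phi> (w (k - 1))) \<longrightarrow>
                fundamental_solution \<phi> \<mu> (\<lambda>k. \<nu> \<star> return borel (w k)) \<and>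
                (w 0 \<in> contraction_subspace \<phi> \<longrightarrow>
                   weakly_converges
                     (\<lambda>k. convolution_prod (\<lambda>i. distr \<mu> borel (\<phi> ^^ (i - 1))) k
                            \<star> return borel (- w (int k)))
                     \<nu>))))"
proof -
  note lin = \<open>linear \<phi>\<close> and bij = \<open>bij \<phi>\<close>
  have \<mu>: "borel_prob \<mu>"
    using assms(1) borel_prob_distr[of P "\<xi> 0"] unfolding noise_with_law_def by metis
  let ?cond = "\<lambda>u. supported_on \<mu> ((+) u ` contraction_subspace \<phi>)"
  have nec: "(\<exists>u. ?cond u) \<and> log_moment_condition \<mu>" if "solution \<phi> \<mu> \<Lambda>" for \<Lambda>
    using solution_imp_support_and_log_moment[OF lin bij_is_inj[OF bij] \<mu> that] by blast
  have fund_sol: "solution \<phi> \<mu> \<Lambda>" if "fundamental_solution \<phi> \<mu> \<Lambda>" for \<Lambda>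
    using that by (simp add: fundamental_solution_def)
  have main: "(\<exists>w :: int \<Rightarrow> real ^ 'n. w 0 = 0 \<and> (\<forall>k. w k = u + \<phi> (w (k - 1)))) \<and>
        (\<exists>\<nu>. strongly_decomposable \<phi> \<nu> (\<mu> \<star> return borel (- u)) \<and>
             \<nu> = ((\<mu> \<star> return borel (- u)) \<star> distr \<nu> borel \<phi>) \<and>
             (\<forall>w :: int \<Rightarrow> real ^ 'n. (\<forall>k. w k = u + \<phi> (w (k - 1))) \<longrightarrow>
                fundamental_solution \<phi> \<mu> (\<lambda>k. \<nu> \<star> return borel (w k)) \<and>
                (w 0 \<in> contraction_subspace \<phi> \<longrightarrow>
                   weakly_converges
                     (\<lambda>k. convolution_prod (\<lambda>i. distr \<mu> borel (\<phi> ^^ (i - 1))) k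
                            \<star> return borel (- w (int k)))
                     \<nu>)))"
    if "?cond u" "log_moment_condition \<mu>" for u
  proof (rule fundamental_solution_exists[OF lin bij \<mu> that], intro conjI affine_orbit_exists[OF bij])
    fix \<nu> assume dec: "strongly_decomposable \<phi> \<nu> (\<mu> \<star> return borel (- u))"
      and fund: "\<And>w :: int \<Rightarrow> real ^ 'n. (\<And>k. w k = u + \<phi> (w (k - 1))) \<Longrightarrow>
        fundamental_solution \<phi> \<mu> (\<lambda>k. \<nu> \<star> return borel (w k))"
      and conv: "\<And>w :: int \<Rightarrow> real ^ 'n. (\<And>k. w k = u + \<phi> (w (k - 1))) \<Longrightarrow> w 0 \<in> contraction_subspace \<phi> \<Longrightarrow>
        weakly_converges (\<lambda>k. convolution_prod (\<lambda>i. distr \<mu> borel (\<phi> ^^ (i - 1))) k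
          \<star> return borel (- w (int k))) \<nu>"
    from dec have "\<nu> = ((\<mu> \<star> return borel (- u)) \<star> distr \<nu> borel \<phi>)"
      unfolding strongly_decomposable_def by blast
    moreover have "\<forall>w :: int \<Rightarrow> real ^ 'n. (\<forall>k. w k = u + \<phi> (w (k - 1))) \<longrightarrow>
        fundamental_solution \<phi> \<mu> (\<lambda>k. \<nu> \<star> return borel (w k)) \<and>
        (w 0 \<in> contraction_subspace \<phi> \<longrightarrow>
          weakly_converges (\<lambda>k. convolution_prod (\<lambda>i. distr \<mu> borel (\<phi> ^^ (i - 1))) k
            \<star> return borel (- w (int k))) \<nu>)"
    proof (intro allI impI conjI)
      fix w :: "int \<Rightarrow> real ^ 'n" assume w: "\<forall>k. w k = u + \<phi> (w (k - 1))"
      show "fundamental_solution \<phi> \<mu> (\<lambda>k. \<nu> \<star> return borel (w k))"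
        by (rule fund[of w, OF w[rule_format]])
      show "weakly_converges (\<lambda>k. convolution_prod (\<lambda>i. distr \<mu> borel (\<phi> ^^ (i - 1))) k
          \<star> return borel (- w (int k))) \<nu>" if "w 0 \<in> contraction_subspace \<phi>"
        by (rule conv[of w, OF w[rule_format] that])
    qed
    ultimately show "\<exists>\<nu>. strongly_decomposable \<phi> \<nu> (\<mu> \<star> return borel (- u)) \<and>
             \<nu> = ((\<mu> \<star> return borel (- u)) \<star> distr \<nu> borel \<phi>) \<and>
             (\<forall>w :: int \<Rightarrow> real ^ 'n. (\<forall>k. w k = u + \<phi> (w (k - 1))) \<longrightarrow>
                fundamental_solution \<phi> \<mu> (\<lambda>k. \<nu> \<star> return borel (w k)) \<and>
                (w 0 \<in> contraction_subspace \<phi> \<longrightarrow>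
                   weakly_converges
                     (\<lambda>k. convolution_prod (\<lambda>i. distr \<mu> borel (\<phi> ^^ (i - 1))) k
                            \<star> return borel (- w (int k)))
                     \<nu>))"
      using dec by (intro exI conjI)
  qed
  have suff: "\<exists>\<Lambda>. fundamental_solution \<phi> \<mu> \<Lambda>"
    if "(\<exists>u. ?cond u) \<and> log_moment_condition \<mu>"
  proof -
    from that obtain u where u: "?cond u" and log: "log_moment_condition \<mu>" by blast
    obtain w :: "int \<Rightarrow> real ^ 'n" where w: "\<And>k. w k = u + \<phi> (w (k - 1))"
      using affine_orbit_exists[OF bij] by blast
    show ?thesis
    proof (rule fundamental_solution_exists[OF lin bij \<mu> u log])
      fix \<nu> assume "\<And>w :: int \<Rightarrow> real ^ 'n. (\<And>k. w k = u + \<phi> (w (k - 1))) \<Longrightarrow>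
        fundamental_solution \<phi> \<mu> (\<lambda>k. \<nu> \<star> return borel (w k))"
      from this[of w, OF w] show ?thesis by blast
    qed
  qed
  have "(\<exists>\<Lambda>. solution \<phi> \<mu> \<Lambda>) \<longleftrightarrow> (\<exists>u. ?cond u) \<and> log_moment_condition \<mu>"
    using nec suff fund_sol by (meson iffI)
  moreover have "(\<exists>\<Lambda>. fundamental_solution \<phi> \<mu> \<Lambda>) \<longleftrightarrow> (\<exists>u. ?cond u) \<and> log_moment_condition \<mu>"
    using nec suff fund_sol by (meson iffI)
  ultimately show ?thesis
    by (rule conjI[OF _ conjI]) (intro allI impI, elim conjE, rule main)
qed

end
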